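(* Let $k$ be an algebraically closed field of characteristic $2$ and let $G=C_2\times C_2$ be the Klein four-group with generators $x,y$. Then the regular module $kG$ is itself a projective indecomposable $kG$-module, namely the projective cover $P_{k_G}$ of the trivial module $k_G$; so the decomposition of $kG$ into projective indecomposable modules is $kG=P_{k_G}$. Putting $X=1-x$ and $Y=1-y$, one has $kG\cong k[X,Y]/\langle X^2,Y^2\rangle$, and the radical layers of $kG$ are, from top to bottom, $k_G$, $k_G\oplus k_G$, $k_G$.
   Context: Modules are finitely generated left modules. $k_G$ is the one-dimensional module on which $G$ acts trivially. The radical layers of a module $U$ are the quotients $\operatorname{rad}^{n-1}U/\operatorname{rad}^{n}U$ ($n\ge 1$, $\operatorname{rad}^0U=U$), listed from top to bottom in order of increasing $n$, where $\operatorname{rad}^nU=\operatorname{rad}(\operatorname{rad}^{n-1}U)$ and $\operatorname{rad}U$ is the intersection of all maximal submodules of $U$. *)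

theory Defs
  imports "HOL-Algebra.Algebra"
begin

text \<open>The order of an element is \<open>0\<close> in the library when it is infinite, which is the usual
  convention for the characteristic as well.\<close>

definition characteristic :: "('a, 'c) ring_scheme \<Rightarrow> nat" where
  "characteristic R = group.ord (add_monoid R) \<one>\<^bsub>R\<^esub>"


section \<open>Modules\<close>

text \<open>Modules are the library's modules over a commutative ring; a group algebra of an abelian group
  is such a ring. A module record contains the fields \<open>mult\<close> and \<open>one\<close>, inherited from the
  ring record. They play no role for modules and are left undefined where a record is built.\<close>

definition module_hom ::
    "('r, 'c) ring_scheme \<Rightarrow> ('r, 'm) module \<Rightarrow> ('r, 'n) module \<Rightarrow> ('m \<Rightarrow> 'n) set" where
  "module_hom R M N = {f \<in> carrier M \<rightarrow> carrier N.
     (\<forall>u \<in> carrier M. \<forall>v \<in> carrier M. f (u \<oplus>\<^bsub>M\<^esub> v) = f u \<oplus>\<^bsub>N\<^esub> f v) \<and>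
     (\<forall>r \<in> carrier R. \<forall>u \<in> carrier M. f (r \<odot>\<^bsub>M\<^esub> u) = r \<odot>\<^bsub>N\<^esub> f u)}"

definition modules_isomorphic ::
    "('r, 'c) ring_scheme \<Rightarrow> ('r, 'm) module \<Rightarrow> ('r, 'n) module \<Rightarrow> bool" where
  "modules_isomorphic R M N \<longleftrightarrow>
     (\<exists>f \<in> module_hom R M N. bij_betw f (carrier M) (carrier N))"

definition fg_module :: "('r, 'c) ring_scheme \<Rightarrow> ('r, 'm) module \<Rightarrow> bool" where
  "fg_module R M \<longleftrightarrow> module R M \<and>
     (\<exists>S. finite S \<and> S \<subseteq> carrier M \<and> (\<forall>H. submodule H R M \<and> S \<subseteq> H \<longrightarrow> H = carrier M))"

definition regular_module :: "('r, 'c) ring_scheme \<Rightarrow> ('r, 'r) module" where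
  "regular_module R = \<lparr>carrier = carrier R, monoid.mult = undefined,
     one = undefined,
     ring.zero = \<zero>\<^bsub>R\<^esub>, add = add R, smult = monoid.mult R\<rparr>"

definition direct_sum_module :: "('r, 'm) module \<Rightarrow> ('r, 'n) module \<Rightarrow> ('r, 'm \<times> 'n) module" where
  "direct_sum_module M N = \<lparr>carrier = carrier M \<times> carrier N, monoid.mult = undefined,
     one = undefined,
     ring.zero = (\<zero>\<^bsub>M\<^esub>, \<zero>\<^bsub>N\<^esub>),
     add = (\<lambda>(u, v) (u', v'). (u \<oplus>\<^bsub>M\<^esub> u', v \<oplus>\<^bsub>N\<^esub> v')),
     smult = (\<lambda>r (u, v). (r \<odot>\<^bsub>M\<^esub> u, r \<odot>\<^bsub>N\<^esub> v))\<rparr>"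

text \<open>For a coset \<open>C = N + m\<close> the set \<open>N + r C\<close> below is the coset \<open>N + r m\<close>.\<close>

definition quotient_module :: "('r, 'm) module \<Rightarrow> 'm set \<Rightarrow> ('r, 'm set) module" where
  "quotient_module M N = \<lparr>carrier = a_rcosets\<^bsub>M\<^esub> N, monoid.mult = undefined,
     one = undefined,
     ring.zero = N, add = set_add M,
     smult = (\<lambda>r C. N <+>\<^bsub>M\<^esub> ((\<lambda>m. r \<odot>\<^bsub>M\<^esub> m) ` C))\<rparr>"

definition indecomposable_module :: "('r, 'c) ring_scheme \<Rightarrow> ('r, 'm) module \<Rightarrow> bool" where
  "indecomposable_module R M \<longleftrightarrow> module R M \<and> carrier M \<noteq> {\<zero>\<^bsub>M\<^esub>} \<and>
     (\<forall>U V. submodule U R M \<and> submodule V R M \<and>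
        U \<inter> V = {\<zero>\<^bsub>M\<^esub>} \<and> U <+>\<^bsub>M\<^esub> V = carrier M \<longrightarrow> U = {\<zero>\<^bsub>M\<^esub>} \<or> V = {\<zero>\<^bsub>M\<^esub>})"

text \<open>Projectivity is the lifting property against all surjective homomorphisms \<open>M \<rightarrow> N\<close>. A HOL
  definition cannot quantify over all types of elements of \<open>M\<close> and \<open>N\<close>, so these two types are
  parameters; a theorem that leaves them as type variables covers all modules.\<close>

definition projective_module ::
    "'m itself \<Rightarrow> 'n itself \<Rightarrow> ('r, 'c) ring_scheme \<Rightarrow> ('r, 'p) module \<Rightarrow> bool" where
  "projective_module tm tn R P \<longleftrightarrow> module R P \<and>
     (\<forall>(M :: ('r, 'm) module) (N :: ('r, 'n) module) f g.
        module R M \<and> module R N \<and> f \<in> module_hom R M N \<and> f ` carrier M = carrier N \<and>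
        g \<in> module_hom R P N \<longrightarrow>
        (\<exists>h \<in> module_hom R P M. \<forall>p \<in> carrier P. f (h p) = g p))"

definition projective_indecomposable ::
    "'m itself \<Rightarrow> 'n itself \<Rightarrow> ('r, 'c) ring_scheme \<Rightarrow> ('r, 'p) module \<Rightarrow> bool" where
  "projective_indecomposable tm tn R P \<longleftrightarrow>
     fg_module R P \<and> projective_module tm tn R P \<and> indecomposable_module R P"

definition projective_cover ::
    "'m itself \<Rightarrow> 'n itself \<Rightarrow> ('r, 'c) ring_scheme \<Rightarrow>
     ('r, 'p) module \<Rightarrow> ('p \<Rightarrow> 'u) \<Rightarrow> ('r, 'u) module \<Rightarrow> bool" where
  "projective_cover tm tn R P \<pi> U \<longleftrightarrow>
     fg_module R P \<and> projective_module tm tn R P \<and> fg_module R U \<and>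
     \<pi> \<in> module_hom R P U \<and> \<pi> ` carrier P = carrier U \<and>
     (\<forall>H. submodule H R P \<and> \<pi> ` H = carrier U \<longrightarrow> H = carrier P)"

definition internal_direct_sum ::
    "('r, 'c) ring_scheme \<Rightarrow> ('r, 'm) module \<Rightarrow> nat \<Rightarrow> (nat \<Rightarrow> 'm set) \<Rightarrow> bool" where
  "internal_direct_sum R M n U \<longleftrightarrow> (\<forall>i<n. submodule (U i) R M) \<and>
     bij_betw (\<lambda>u. \<Oplus>\<^bsub>M\<^esub>i\<in>{..<n}. u i) (Pi\<^sub>E {..<n} U) (carrier M)"

definition pim_decomposition ::
    "'a itself \<Rightarrow> 'b itself \<Rightarrow> ('r, 'c) ring_scheme \<Rightarrow>
     ('r, 'm) module \<Rightarrow> nat \<Rightarrow> (nat \<Rightarrow> 'm set) \<Rightarrow> bool" where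
  "pim_decomposition ta tb R M n U \<longleftrightarrow> internal_direct_sum R M n U \<and>
     (\<forall>i<n. projective_indecomposable ta tb R (M\<lparr>carrier := U i\<rparr>))"


section \<open>Radical layers\<close>

definition maximal_submodule :: "'m set \<Rightarrow> ('r, 'c) ring_scheme \<Rightarrow> ('r, 'm) module \<Rightarrow> bool" where
  "maximal_submodule N R M \<longleftrightarrow> submodule N R M \<and> N \<noteq> carrier M \<and>
     (\<forall>H. submodule H R M \<and> N \<subseteq> H \<longrightarrow> H = N \<or> H = carrier M)"

definition rad :: "('r, 'c) ring_scheme \<Rightarrow> ('r, 'm) module \<Rightarrow> 'm set" where
  "rad R M = carrier M \<inter> \<Inter>{N. maximal_submodule N R M}"

primrec rad_pow :: "('r, 'c) ring_scheme \<Rightarrow> ('r, 'm) module \<Rightarrow> nat \<Rightarrow> 'm set" where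
  "rad_pow R M 0 = carrier M"
| "rad_pow R M (Suc n) = rad R (M\<lparr>carrier := rad_pow R M n\<rparr>)"

definition radical_layer ::
    "('r, 'c) ring_scheme \<Rightarrow> ('r, 'm) module \<Rightarrow> nat \<Rightarrow> ('r, 'm set) module" where
  "radical_layer R M n =
     quotient_module (M\<lparr>carrier := rad_pow R M (n - 1)\<rparr>) (rad_pow R M n)"


section \<open>The group algebra of a finite group\<close>

text \<open>The function \<open>a\<close> stands for the formal sum of the \<open>a g \<cdot> g\<close>. Finiteness of the group is
  assumed throughout: no finite support is imposed and the sums range over the whole group.
  The field \<open>smult\<close> is multiplication by scalars from \<open>K\<close>.\<close>

definition group_algebra ::
    "('k, 'c) ring_scheme \<Rightarrow> ('g, 'd) monoid_scheme \<Rightarrow> ('k, 'g \<Rightarrow> 'k) module" where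
  "group_algebra K G = \<lparr>carrier = carrier G \<rightarrow>\<^sub>E carrier K,
     monoid.mult = (\<lambda>a b. \<lambda>g\<in>carrier G. \<Oplus>\<^bsub>K\<^esub>h\<in>carrier G. a h \<otimes>\<^bsub>K\<^esub> b (inv\<^bsub>G\<^esub> h \<otimes>\<^bsub>G\<^esub> g)),
     one = (\<lambda>g\<in>carrier G. if g = \<one>\<^bsub>G\<^esub> then \<one>\<^bsub>K\<^esub> else \<zero>\<^bsub>K\<^esub>),
     ring.zero = (\<lambda>g\<in>carrier G. \<zero>\<^bsub>K\<^esub>),
     add = (\<lambda>a b. \<lambda>g\<in>carrier G. a g \<oplus>\<^bsub>K\<^esub> b g),
     smult = (\<lambda>c a. \<lambda>g\<in>carrier G. c \<otimes>\<^bsub>K\<^esub> a g)\<rparr>"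

definition group_element ::
    "('k, 'c) ring_scheme \<Rightarrow> ('g, 'd) monoid_scheme \<Rightarrow> 'g \<Rightarrow> ('g \<Rightarrow> 'k)" where
  "group_element K G x = (\<lambda>g\<in>carrier G. if g = x then \<one>\<^bsub>K\<^esub> else \<zero>\<^bsub>K\<^esub>)"

text \<open>Every group element acts as the identity on the one-dimensional space \<open>K\<close>, so the formal sum
  of the \<open>a g \<cdot> g\<close> acts as the scalar that is the sum of its coefficients.\<close>

definition trivial_module ::
    "('k, 'c) ring_scheme \<Rightarrow> ('g, 'd) monoid_scheme \<Rightarrow> ('g \<Rightarrow> 'k, 'k) module" where
  "trivial_module K G = \<lparr>carrier = carrier K, monoid.mult = undefined,
     one = undefined,
     ring.zero = \<zero>\<^bsub>K\<^esub>, add = add K,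
     smult = (\<lambda>a v. (\<Oplus>\<^bsub>K\<^esub>g\<in>carrier G. a g) \<otimes>\<^bsub>K\<^esub> v)\<rparr>"


section \<open>Polynomials in two variables\<close>

text \<open>\<open>K[X, Y]\<close> is \<open>K[X][Y]\<close>.\<close>

abbreviation poly2 :: "('k, 'c) ring_scheme \<Rightarrow> (nat \<Rightarrow> 'k, nat \<Rightarrow> nat \<Rightarrow> 'k) up_ring" where
  "poly2 K \<equiv> UP (UP K)"

definition poly2_const :: "('k, 'c) ring_scheme \<Rightarrow> 'k \<Rightarrow> (nat \<Rightarrow> nat \<Rightarrow> 'k)" where
  "poly2_const K c = up_ring.monom (UP (UP K)) (up_ring.monom (UP K) c 0) 0"

definition poly2_X :: "('k, 'c) ring_scheme \<Rightarrow> (nat \<Rightarrow> nat \<Rightarrow> 'k)" where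
  "poly2_X K = up_ring.monom (UP (UP K)) (up_ring.monom (UP K) \<one>\<^bsub>K\<^esub> 1) 0"

definition poly2_Y :: "('k, 'c) ring_scheme \<Rightarrow> (nat \<Rightarrow> nat \<Rightarrow> 'k)" where
  "poly2_Y K = up_ring.monom (UP (UP K)) \<one>\<^bsub>UP K\<^esub> 1"

definition ideal_X2_Y2 :: "('k, 'c) ring_scheme \<Rightarrow> (nat \<Rightarrow> nat \<Rightarrow> 'k) set" where
  "ideal_X2_Y2 K =
     genideal (poly2 K) {poly2_X K [^]\<^bsub>poly2 K\<^esub> (2::nat), poly2_Y K [^]\<^bsub>poly2 K\<^esub> (2::nat)}"

end

theory Submission
  imports Defs
begin

text \<open>Write \<open>A = KG\<close>, \<open>\<xi> = 1 - x\<close>, \<open>\<eta> = 1 - y\<close>. In characteristic \<open>2\<close> the relations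
\<open>x\<^sup>2 = y\<^sup>2 = 1\<close> become \<open>\<xi>\<^sup>2 = \<eta>\<^sup>2 = 0\<close>, and \<open>\<xi> \<eta> = 1 + x + y + x y\<close> is nonzero because the four group
elements are distinct. The elements \<open>1, \<xi>, \<eta>, \<xi> \<eta>\<close> span \<open>A\<close>, and the augmentation
\<open>\<epsilon> : A \<rightarrow> K\<close> picks out the coefficient of \<open>1\<close>. These facts are the assumptions of the locale
\<open>square_zero_algebra\<close>; linear independence of the four elements follows from them. Everything about
modules is then proved in that locale, over an arbitrary field.

Ideals of \<open>A\<close> are governed by the two extreme lines of the basis. Multiplying a nonzero element by
a suitable basis element produces a nonzero multiple of \<open>\<xi> \<eta>\<close>, so \<open>\<xi> \<eta>\<close> lies in every nonzero
ideal (\<open>XY_in_ideal\<close>); and an ideal that contains an element with nonzero augmentation is all of \<open>A\<close>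
(\<open>ideal_eq_carrier\<close>). From the first fact, two nonzero submodules of the regular module always
meet, so the regular module, which is free of rank one and hence projective, is indecomposable and no
decomposition can have two nonzero summands. From the second fact, a submodule on which \<open>\<epsilon>\<close> is
still surjective is everything, so \<open>\<epsilon>\<close> is a projective cover of the trivial module.

The radical series is \<open>A \<supset> ker \<epsilon> \<supset> K \<xi> \<eta> \<supset> 0\<close>. The kernel of \<open>\<epsilon>\<close> is the only maximal submodule
of \<open>A\<close>. In \<open>ker \<epsilon>\<close> the annihilators of \<open>\<xi>\<close> and of \<open>\<eta>\<close> are maximal and meet in the line
\<open>K \<xi> \<eta>\<close>, which conversely lies in every maximal submodule. The line \<open>K \<xi> \<eta>\<close> is simple. On the three
quotients \<open>A\<close> acts through \<open>\<epsilon>\<close>, and coordinates with respect to the basis give the isomorphisms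
with \<open>k\<close>, \<open>k \<oplus> k\<close> and \<open>k\<close>.

For the presentation, evaluation \<open>K[X, Y] \<rightarrow> A\<close> at \<open>(\<xi>, \<eta>)\<close> is surjective. Modulo \<open>X\<^sup>2\<close> and \<open>Y\<^sup>2\<close>
every polynomial is a combination of \<open>1, X, Y, X Y\<close>, and such a combination evaluates to \<open>0\<close> only if
its coefficients vanish, so the kernel is exactly the ideal generated by \<open>X\<^sup>2\<close> and \<open>Y\<^sup>2\<close>.\<close>

section \<open>Modules and ideals\<close>

text \<open>Closure under negation follows from multiplication by \<open>- 1\<close>. This form of the
definition mentions no inverses, which in \<open>M\<lparr>carrier := H\<rparr>\<close> are taken relative to the smaller carrier.\<close>

lemma submodule_iff:
  assumes "module R M"
  shows "submodule H R M \<longleftrightarrow> H \<subseteq> carrier M \<and> \<zero>\<^bsub>M\<^esub> \<in> H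
    \<and> (\<forall>a\<in>H. \<forall>b\<in>H. a \<oplus>\<^bsub>M\<^esub> b \<in> H) \<and> (\<forall>r\<in>carrier R. \<forall>a\<in>H. r \<odot>\<^bsub>M\<^esub> a \<in> H)"
    (is "_ \<longleftrightarrow> ?P")
proof
  interpret module R M by fact
  assume H: "submodule H R M"
  then interpret submodule H R M .
  show ?P
    using submoduleE[OF H] one_closed by auto
next
  interpret module R M by fact
  assume P: ?P
  show "submodule H R M"
  proof (rule submoduleI)
    fix a assume a: "a \<in> H"
    then have "\<ominus>\<^bsub>M\<^esub> a = (\<ominus>\<^bsub>R\<^esub> \<one>\<^bsub>R\<^esub>) \<odot>\<^bsub>M\<^esub> a"
      using P by (subst smult_l_minus) auto
    then show "\<ominus>\<^bsub>M\<^esub> a \<in> H" using P a by auto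
  qed (use P in auto)
qed

lemma regular_module_simps [simp]:
  "carrier (regular_module R) = carrier R"
  "\<zero>\<^bsub>regular_module R\<^esub> = \<zero>\<^bsub>R\<^esub>"
  "add (regular_module R) = add R"
  "smult (regular_module R) = monoid.mult R"
  by (simp_all add: regular_module_def)

lemma finsum_regular_module: "finsum (regular_module R) = finsum R"
  by (intro ext) (simp add: finsum_def finprod_def)

lemma module_regular:
  assumes "cring R"
  shows "module R (regular_module R)"
proof -
  interpret cring R by fact
  show ?thesis
  proof (rule moduleI)
    show "abelian_group (regular_module R)"
      by (rule abelian_groupI) (auto simp: a_ac intro: l_neg)
  qed (auto simp: assms l_distr r_distr m_assoc)
qed

lemma (in cring) ideal_iff:
  "ideal H R \<longleftrightarrow> H \<subseteq> carrier R \<and> \<zero> \<in> H \<and> (\<forall>a\<in>H. \<forall>b\<in>H. a \<oplus> b \<in> H)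
    \<and> (\<forall>r\<in>carrier R. \<forall>a\<in>H. r \<otimes> a \<in> H)" (is "_ \<longleftrightarrow> ?P")
proof
  assume "ideal H R"
  then interpret ideal H R .
  show ?P using a_subset by (auto intro: I_l_closed)
next
  assume P: ?P
  have "\<ominus> a \<in> H" if "a \<in> H" for a
  proof -
    have "\<ominus> a = (\<ominus> \<one>) \<otimes> a" using P that by (auto simp: l_minus)
    then show ?thesis using P that by auto
  qed
  then have "subgroup H (add_monoid R)"
    using P by (intro add.subgroupI) auto
  moreover have "a \<otimes> r \<in> H" if "a \<in> H" "r \<in> carrier R" for a r
    using P that m_comm[of a r] by auto
  ultimately show "ideal H R"
    using P by (intro idealI ring_axioms) auto
qed

lemma module_ideal:
  assumes "cring R" and "ideal N R"
  shows "module R (regular_module R\<lparr>carrier := N\<rparr>)"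
proof -
  interpret cring R by fact
  have "submodule N R (regular_module R)"
    using assms(2) ideal_iff[of N] by (simp add: submodule_iff[OF module_regular[OF assms(1)]])
  then show ?thesis
    by (rule submodule.submodule_is_module) (rule module_regular[OF assms(1)])
qed

text \<open>The modules in the radical series of the regular module are ideals with the restricted
operations; this turns questions about their submodules into questions about ideals of the ring.\<close>

lemma submodule_regular_iff:
  assumes "cring R" and "ideal N R"
  shows "submodule H R (regular_module R\<lparr>carrier := N\<rparr>) \<longleftrightarrow> ideal H R \<and> H \<subseteq> N"
proof -
  interpret cring R by fact
  have "N \<subseteq> carrier R" using assms(2) ideal_iff[of N] by simp
  then show ?thesis
    using ideal_iff[of H] by (auto simp: submodule_iff[OF module_ideal[OF assms]])
qed

lemma fg_module_regular:
  assumes "cring R"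
  shows "fg_module R (regular_module R)"
proof -
  interpret cring R by fact
  have "H = carrier R" if "submodule H R (regular_module R)" "\<one>\<^bsub>R\<^esub> \<in> H" for H
  proof -
    have "a \<in> H" if a: "a \<in> carrier R" for a
      using \<open>submodule H R _\<close> \<open>\<one>\<^bsub>R\<^esub> \<in> H\<close> a r_one[OF a] submodule.smult_closed
      by (metis regular_module_simps(4))
    then show ?thesis
      using that(1) by (auto simp: submodule_iff[OF module_regular[OF assms]])
  qed
  then show ?thesis
    using module_regular[OF assms]
    unfolding fg_module_def by (intro conjI exI[of _ "{\<one>\<^bsub>R\<^esub>}"]) auto
qed

text \<open>The regular module is free on \<open>1\<close>: a preimage \<open>m\<close> of \<open>g 1\<close> determines the lift \<open>r \<mapsto> r m\<close>.\<close>

lemma projective_module_regular: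
  assumes "cring R"
  shows "projective_module TYPE('m) TYPE('n) R (regular_module R)"
  unfolding projective_module_def
proof (intro conjI allI impI)
  show "module R (regular_module R)" using assms by (rule module_regular)
next
  interpret cring R by fact
  fix M :: "('a, 'm) module" and N :: "('a, 'n) module" and f g
  assume "module R M \<and> module R N \<and> f \<in> module_hom R M N \<and> f ` carrier M = carrier N
    \<and> g \<in> module_hom R (regular_module R) N"
  then have M: "module R M" and N: "module R N" and f: "f \<in> module_hom R M N"
    and surj: "f ` carrier M = carrier N" and g: "g \<in> module_hom R (regular_module R) N"
    by auto
  interpret M: module R M by (rule M)
  have "g \<one>\<^bsub>R\<^esub> \<in> carrier N" using g by (auto simp: module_hom_def)
  then obtain m where m: "m \<in> carrier M" "f m = g \<one>\<^bsub>R\<^esub>" using surj by (metis imageE)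
  have "(\<lambda>r. r \<odot>\<^bsub>M\<^esub> m) \<in> module_hom R (regular_module R) M"
    using m by (auto simp: module_hom_def M.smult_l_distr M.smult_assoc1)
  moreover have "f (r \<odot>\<^bsub>M\<^esub> m) = g r" if r: "r \<in> carrier R" for r
  proof -
    have "g (r \<otimes>\<^bsub>R\<^esub> \<one>\<^bsub>R\<^esub>) = r \<odot>\<^bsub>N\<^esub> g \<one>\<^bsub>R\<^esub>"
      using g r one_closed unfolding module_hom_def regular_module_simps by blast
    moreover have "f (r \<odot>\<^bsub>M\<^esub> m) = r \<odot>\<^bsub>N\<^esub> f m" using f r m by (simp add: module_hom_def)
    ultimately show ?thesis using m r by simp
  qed
  ultimately show "\<exists>h\<in>module_hom R (regular_module R) M.
      \<forall>p\<in>carrier (regular_module R). f (h p) = g p"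
    by (intro bexI[of _ "\<lambda>r. r \<odot>\<^bsub>M\<^esub> m"]) auto
qed

lemma direct_sum_module_simps [simp]:
  "carrier (direct_sum_module M N) = carrier M \<times> carrier N"
  "\<zero>\<^bsub>direct_sum_module M N\<^esub> = (\<zero>\<^bsub>M\<^esub>, \<zero>\<^bsub>N\<^esub>)"
  "(u, v) \<oplus>\<^bsub>direct_sum_module M N\<^esub> (u', v') = (u \<oplus>\<^bsub>M\<^esub> u', v \<oplus>\<^bsub>N\<^esub> v')"
  "r \<odot>\<^bsub>direct_sum_module M N\<^esub> (u, v) = (r \<odot>\<^bsub>M\<^esub> u, r \<odot>\<^bsub>N\<^esub> v)"
  by (simp_all add: direct_sum_module_def)

lemma module_direct_sum:
  assumes "module R M" and "module R N"
  shows "module R (direct_sum_module M N)"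
proof -
  interpret M: module R M by fact
  interpret N: module R N by fact
  show ?thesis
  proof (rule moduleI)
    show "abelian_group (direct_sum_module M N)"
    proof (rule abelian_groupI)
      fix x assume "x \<in> carrier (direct_sum_module M N)"
      then show "\<exists>y\<in>carrier (direct_sum_module M N).
          y \<oplus>\<^bsub>direct_sum_module M N\<^esub> x = \<zero>\<^bsub>direct_sum_module M N\<^esub>"
        by (intro bexI[of _ "(\<ominus>\<^bsub>M\<^esub> fst x, \<ominus>\<^bsub>N\<^esub> snd x)"]) (auto simp: M.l_neg N.l_neg)
    qed (auto simp: M.a_ac N.a_ac)
  qed (auto simp: M.smult_l_distr N.smult_l_distr M.smult_r_distr N.smult_r_distr
      M.smult_assoc1 N.smult_assoc1 M.is_cring)
qed

text \<open>The first isomorphism theorem. The submodule \<open>H\<close> is a parameter equal to the kernel, because in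
the applications it is already known as a power of the radical.\<close>

lemma modules_isomorphic_quotient:
  assumes "module R M" and "module R N" and f: "f \<in> module_hom R M N"
    and surj: "f ` carrier M = carrier N" and H: "H = {m \<in> carrier M. f m = \<zero>\<^bsub>N\<^esub>}"
  shows "modules_isomorphic R (quotient_module M H) N"
proof -
  interpret M: module R M by fact
  interpret N: module R N by fact
  have fc: "f m \<in> carrier N" if "m \<in> carrier M" for m
    using f that by (auto simp: module_hom_def)
  have fa: "f (m \<oplus>\<^bsub>M\<^esub> m') = f m \<oplus>\<^bsub>N\<^esub> f m'" if "m \<in> carrier M" "m' \<in> carrier M" for m m'
    using f that by (auto simp: module_hom_def)
  have fs: "f (r \<odot>\<^bsub>M\<^esub> m) = r \<odot>\<^bsub>N\<^esub> f m" if "r \<in> carrier R" "m \<in> carrier M" for r m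
    using f that by (auto simp: module_hom_def)
  have f0: "f \<zero>\<^bsub>M\<^esub> = \<zero>\<^bsub>N\<^esub>"
    using fa[of "\<zero>\<^bsub>M\<^esub>" "\<zero>\<^bsub>M\<^esub>"] fc[of "\<zero>\<^bsub>M\<^esub>"] by (simp add: N.add.r_cancel_one')
  have sub: "submodule H R M"
    by (subst submodule_iff[OF assms(1)]) (auto simp: H f0 fa fs)
  interpret H: abelian_subgroup H M
    using sub by (intro abelian_subgroupI3 additive_subgroup.intro M.abelian_group_axioms)
      (simp add: submodule_def)
  have Hmem: "h \<in> H \<longleftrightarrow> h \<in> carrier M \<and> f h = \<zero>\<^bsub>N\<^esub>" for h
    using H by blast
  have mem: "c \<in> H +>\<^bsub>M\<^esub> m \<longleftrightarrow> c \<in> carrier M \<and> f c = f m" if m: "m \<in> carrier M" for c m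
  proof
    assume "c \<in> H +>\<^bsub>M\<^esub> m"
    then obtain h where "h \<in> H" "c = h \<oplus>\<^bsub>M\<^esub> m" by (auto simp: a_r_coset_def')
    then show "c \<in> carrier M \<and> f c = f m" using m Hmem[of h] by (auto simp: fa fc)
  next
    assume c: "c \<in> carrier M \<and> f c = f m"
    have "f (c \<ominus>\<^bsub>M\<^esub> m) \<oplus>\<^bsub>N\<^esub> f m = f c"
      using c m by (subst fa[symmetric]) (auto simp: M.minus_eq M.a_assoc M.l_neg)
    then have "f (c \<ominus>\<^bsub>M\<^esub> m) = \<zero>\<^bsub>N\<^esub>"
      using c m fc[of "c \<ominus>\<^bsub>M\<^esub> m"] fc[of m] by (simp add: N.add.r_cancel_one')
    moreover have "c = (c \<ominus>\<^bsub>M\<^esub> m) \<oplus>\<^bsub>M\<^esub> m"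
      using c m by (simp add: M.minus_eq M.a_assoc M.l_neg)
    ultimately show "c \<in> H +>\<^bsub>M\<^esub> m"
      using c m Hmem[of "c \<ominus>\<^bsub>M\<^esub> m"] unfolding a_r_coset_def' by auto
  qed
  have im: "f ` (H +>\<^bsub>M\<^esub> m) = {f m}" if m: "m \<in> carrier M" for m
    using mem[OF m] m by auto
  have qc: "carrier (quotient_module M H) = (\<lambda>m. H +>\<^bsub>M\<^esub> m) ` carrier M"
    by (auto simp: quotient_module_def A_RCOSETS_def')
  have qs: "r \<odot>\<^bsub>quotient_module M H\<^esub> (H +>\<^bsub>M\<^esub> m) = H +>\<^bsub>M\<^esub> (r \<odot>\<^bsub>M\<^esub> m)"
    if r: "r \<in> carrier R" and m: "m \<in> carrier M" for r m
  proof -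
    have "c \<in> H <+>\<^bsub>M\<^esub> ((\<lambda>m. r \<odot>\<^bsub>M\<^esub> m) ` (H +>\<^bsub>M\<^esub> m)) \<longleftrightarrow> c \<in> H +>\<^bsub>M\<^esub> (r \<odot>\<^bsub>M\<^esub> m)" for c
    proof
      assume "c \<in> H <+>\<^bsub>M\<^esub> ((\<lambda>m. r \<odot>\<^bsub>M\<^esub> m) ` (H +>\<^bsub>M\<^esub> m))"
      then obtain h d where "h \<in> H" "d \<in> H +>\<^bsub>M\<^esub> m" "c = h \<oplus>\<^bsub>M\<^esub> r \<odot>\<^bsub>M\<^esub> d"
        by (auto simp: set_add_def')
      then show "c \<in> H +>\<^bsub>M\<^esub> (r \<odot>\<^bsub>M\<^esub> m)"
        using r m mem[OF m, of d] Hmem[of h] by (subst mem) (auto simp: fa fs fc)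
    next
      assume "c \<in> H +>\<^bsub>M\<^esub> (r \<odot>\<^bsub>M\<^esub> m)"
      then show "c \<in> H <+>\<^bsub>M\<^esub> ((\<lambda>m. r \<odot>\<^bsub>M\<^esub> m) ` (H +>\<^bsub>M\<^esub> m))"
        using mem[OF m, of m] m unfolding set_add_def' a_r_coset_def'[of M H "r \<odot>\<^bsub>M\<^esub> m"] by blast
    qed
    then show ?thesis by (auto simp: quotient_module_def)
  qed
  have qa: "(H +>\<^bsub>M\<^esub> m) \<oplus>\<^bsub>quotient_module M H\<^esub> (H +>\<^bsub>M\<^esub> m') = H +>\<^bsub>M\<^esub> (m \<oplus>\<^bsub>M\<^esub> m')"
    if "m \<in> carrier M" "m' \<in> carrier M" for m m'
    using H.a_rcos_sum[OF that] by (simp add: quotient_module_def)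
  let ?F = "\<lambda>C. the_elem (f ` C)"
  have F: "?F (H +>\<^bsub>M\<^esub> m) = f m" if "m \<in> carrier M" for m
    using im[OF that] by simp
  have "?F \<in> module_hom R (quotient_module M H) N"
    unfolding module_hom_def qc by (auto simp: F fc qa qs fa fs)
  moreover have "bij_betw ?F (carrier (quotient_module M H)) (carrier N)"
  proof (rule bij_betw_imageI)
    show "inj_on ?F (carrier (quotient_module M H))"
    proof (rule inj_onI)
      fix C D assume "C \<in> carrier (quotient_module M H)" "D \<in> carrier (quotient_module M H)"
        and eq: "?F C = ?F D"
      then obtain m m' where m: "m \<in> carrier M" "C = H +>\<^bsub>M\<^esub> m"
        and m': "m' \<in> carrier M" "D = H +>\<^bsub>M\<^esub> m'"
        unfolding qc by blast
      have "f m = f m'" using eq F[OF m(1)] F[OF m'(1)] unfolding m(2) m'(2) by simp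
      then show "C = D"
        unfolding m(2) m'(2) by (simp only: set_eq_iff mem[OF m(1)] mem[OF m'(1)] simp_thms)
    qed
    show "?F ` carrier (quotient_module M H) = carrier N"
      unfolding qc surj[symmetric] image_image by (rule image_cong) (simp_all only: F)
  qed
  ultimately show ?thesis unfolding modules_isomorphic_def by blast
qed

text \<open>The one-dimensional module on which \<open>R\<close> acts through a ring homomorphism \<open>\<epsilon>\<close> to \<open>K\<close>. With the
augmentation for \<open>\<epsilon>\<close> it is the trivial module of a group algebra.\<close>

definition scalar_restriction :: "('k, 'c) ring_scheme \<Rightarrow> ('r \<Rightarrow> 'k) \<Rightarrow> ('r, 'k) module" where
  "scalar_restriction K \<epsilon> = \<lparr>carrier = carrier K, monoid.mult = undefined, one = undefined,
     ring.zero = \<zero>\<^bsub>K\<^esub>, add = add K, smult = (\<lambda>a v. \<epsilon> a \<otimes>\<^bsub>K\<^esub> v)\<rparr>"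

lemma scalar_restriction_simps [simp]:
  "carrier (scalar_restriction K \<epsilon>) = carrier K"
  "\<zero>\<^bsub>scalar_restriction K \<epsilon>\<^esub> = \<zero>\<^bsub>K\<^esub>"
  "add (scalar_restriction K \<epsilon>) = add K"
  "a \<odot>\<^bsub>scalar_restriction K \<epsilon>\<^esub> v = \<epsilon> a \<otimes>\<^bsub>K\<^esub> v"
  by (simp_all add: scalar_restriction_def)

lemma module_scalar_restriction:
  assumes "cring R" and "cring K" and "\<epsilon> \<in> ring_hom R K"
  shows "module R (scalar_restriction K \<epsilon>)"
proof -
  interpret R: cring R by fact
  interpret K: cring K by fact
  interpret ring_hom_cring R K \<epsilon> by unfold_locales fact
  show ?thesis
  proof (rule moduleI)
    show "abelian_group (scalar_restriction K \<epsilon>)"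
      by (rule abelian_groupI) (auto simp: K.a_ac intro: K.l_neg)
  qed (auto simp: assms K.l_distr K.r_distr K.m_assoc)
qed

section \<open>Algebras of the shape of \<open>K[X, Y] / (X\<^sup>2, Y\<^sup>2)\<close>\<close>

text \<open>The elements \<open>\<xi>\<close> and \<open>\<eta>\<close> are the images of the variables \<open>X\<close> and \<open>Y\<close>, and lemma names use these
letters. The map \<open>\<iota>\<close> is the structure map of the \<open>K\<close>-algebra and \<open>\<epsilon>\<close> its augmentation. Linear
independence of \<open>1, \<xi>, \<eta>, \<xi> \<eta>\<close> follows from \<open>\<xi> \<eta> \<noteq> 0\<close>, see \<open>elt_eq_zero\<close>.\<close>

locale square_zero_algebra = A?: cring A + K: field K
  for A (structure) and K :: "('k, 'c) ring_scheme" +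
  fixes \<iota> \<epsilon> \<xi> \<eta>
  assumes iota_hom: "\<iota> \<in> ring_hom K A" and eps_hom: "\<epsilon> \<in> ring_hom A K"
    and eps_iota [simp]: "c \<in> carrier K \<Longrightarrow> \<epsilon> (\<iota> c) = c"
    and X_closed [simp]: "\<xi> \<in> carrier A" and Y_closed [simp]: "\<eta> \<in> carrier A"
    and X_sq: "\<xi> \<otimes> \<xi> = \<zero>" and Y_sq: "\<eta> \<otimes> \<eta> = \<zero>" and XY_nonzero: "\<xi> \<otimes> \<eta> \<noteq> \<zero>"
    and span: "a \<in> carrier A \<Longrightarrow> \<exists>\<alpha>\<in>carrier K. \<exists>\<beta>\<in>carrier K. \<exists>\<gamma>\<in>carrier K. \<exists>\<delta>\<in>carrier K.
      a = \<iota> \<alpha> \<oplus> \<iota> \<beta> \<otimes> \<xi> \<oplus> \<iota> \<gamma> \<otimes> \<eta> \<oplus> \<iota> \<delta> \<otimes> (\<xi> \<otimes> \<eta>)"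
begin

sublocale iota: ring_hom_cring K A \<iota>
  by unfold_locales (rule iota_hom)

sublocale eps: ring_hom_cring A K \<epsilon>
  by unfold_locales (rule eps_hom)

definition elt :: "'k \<Rightarrow> 'k \<Rightarrow> 'k \<Rightarrow> 'k \<Rightarrow> 'a" where
  "elt \<alpha> \<beta> \<gamma> \<delta> = \<iota> \<alpha> \<oplus> \<iota> \<beta> \<otimes> \<xi> \<oplus> \<iota> \<gamma> \<otimes> \<eta> \<oplus> \<iota> \<delta> \<otimes> (\<xi> \<otimes> \<eta>)"

lemma elt_closed [simp]:
  "\<lbrakk>\<alpha> \<in> carrier K; \<beta> \<in> carrier K; \<gamma> \<in> carrier K; \<delta> \<in> carrier K\<rbrakk> \<Longrightarrow> elt \<alpha> \<beta> \<gamma> \<delta> \<in> carrier A"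
  by (simp add: elt_def)

text \<open>The squares of \<open>\<epsilon> \<xi>\<close> and \<open>\<epsilon> \<eta>\<close> vanish, and a field has no nonzero nilpotent elements.\<close>

lemma eps_XY [simp]: "\<epsilon> \<xi> = \<zero>\<^bsub>K\<^esub>" "\<epsilon> \<eta> = \<zero>\<^bsub>K\<^esub>"
proof -
  have "\<epsilon> \<xi> \<otimes>\<^bsub>K\<^esub> \<epsilon> \<xi> = \<zero>\<^bsub>K\<^esub>" "\<epsilon> \<eta> \<otimes>\<^bsub>K\<^esub> \<epsilon> \<eta> = \<zero>\<^bsub>K\<^esub>"
    by (simp_all flip: eps.hom_mult add: X_sq Y_sq)
  then show "\<epsilon> \<xi> = \<zero>\<^bsub>K\<^esub>" "\<epsilon> \<eta> = \<zero>\<^bsub>K\<^esub>"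
    using K.integral[of "\<epsilon> \<xi>" "\<epsilon> \<xi>"] K.integral[of "\<epsilon> \<eta>" "\<epsilon> \<eta>"] by auto
qed

lemma eps_elt [simp]:
  "\<lbrakk>\<alpha> \<in> carrier K; \<beta> \<in> carrier K; \<gamma> \<in> carrier K; \<delta> \<in> carrier K\<rbrakk> \<Longrightarrow> \<epsilon> (elt \<alpha> \<beta> \<gamma> \<delta>) = \<alpha>"
  by (simp add: elt_def)

lemma coordinates:
  assumes "a \<in> carrier A"
  obtains \<beta> \<gamma> \<delta> where "\<beta> \<in> carrier K" "\<gamma> \<in> carrier K" "\<delta> \<in> carrier K" "a = elt (\<epsilon> a) \<beta> \<gamma> \<delta>"
  using span[OF assms] unfolding elt_def[symmetric] by force

lemma XY_mult:
  "\<xi> \<otimes> (\<xi> \<otimes> \<eta>) = \<zero>" "\<eta> \<otimes> (\<xi> \<otimes> \<eta>) = \<zero>"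
proof -
  have "\<xi> \<otimes> (\<xi> \<otimes> \<eta>) = (\<xi> \<otimes> \<xi>) \<otimes> \<eta>" "\<eta> \<otimes> (\<xi> \<otimes> \<eta>) = \<xi> \<otimes> (\<eta> \<otimes> \<eta>)"
    using X_closed Y_closed by (algebra, algebra)
  then show "\<xi> \<otimes> (\<xi> \<otimes> \<eta>) = \<zero>" "\<eta> \<otimes> (\<xi> \<otimes> \<eta>) = \<zero>"
    by (simp_all add: X_sq Y_sq)
qed

lemma elt_mult_X:
  assumes [simp]: "\<alpha> \<in> carrier K" "\<beta> \<in> carrier K" "\<gamma> \<in> carrier K" "\<delta> \<in> carrier K"
  shows "elt \<alpha> \<beta> \<gamma> \<delta> \<otimes> \<xi> = \<iota> \<alpha> \<otimes> \<xi> \<oplus> \<iota> \<gamma> \<otimes> (\<xi> \<otimes> \<eta>)"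
proof -
  have "(a \<oplus> b \<otimes> \<xi> \<oplus> c \<otimes> \<eta> \<oplus> d \<otimes> (\<xi> \<otimes> \<eta>)) \<otimes> \<xi>
      = a \<otimes> \<xi> \<oplus> c \<otimes> (\<xi> \<otimes> \<eta>) \<oplus> (\<xi> \<otimes> \<xi>) \<otimes> (b \<oplus> d \<otimes> \<eta>)"
    if "a \<in> carrier A" "b \<in> carrier A" "c \<in> carrier A" "d \<in> carrier A" for a b c d
    using that X_closed Y_closed by algebra
  then show ?thesis by (simp add: elt_def X_sq)
qed

lemma elt_mult_Y:
  assumes [simp]: "\<alpha> \<in> carrier K" "\<beta> \<in> carrier K" "\<gamma> \<in> carrier K" "\<delta> \<in> carrier K"
  shows "elt \<alpha> \<beta> \<gamma> \<delta> \<otimes> \<eta> = \<iota> \<alpha> \<otimes> \<eta> \<oplus> \<iota> \<beta> \<otimes> (\<xi> \<otimes> \<eta>)"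
proof -
  have "(a \<oplus> b \<otimes> \<xi> \<oplus> c \<otimes> \<eta> \<oplus> d \<otimes> (\<xi> \<otimes> \<eta>)) \<otimes> \<eta>
      = a \<otimes> \<eta> \<oplus> b \<otimes> (\<xi> \<otimes> \<eta>) \<oplus> (\<eta> \<otimes> \<eta>) \<otimes> (c \<oplus> d \<otimes> \<xi>)"
    if "a \<in> carrier A" "b \<in> carrier A" "c \<in> carrier A" "d \<in> carrier A" for a b c d
    using that X_closed Y_closed by algebra
  then show ?thesis by (simp add: elt_def Y_sq)
qed

lemma mult_XY:
  assumes a: "a \<in> carrier A"
  shows "a \<otimes> (\<xi> \<otimes> \<eta>) = \<iota> (\<epsilon> a) \<otimes> (\<xi> \<otimes> \<eta>)"
proof -
  obtain \<beta> \<gamma> \<delta> where k: "\<beta> \<in> carrier K" "\<gamma> \<in> carrier K" "\<delta> \<in> carrier K"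
    and e: "a = elt (\<epsilon> a) \<beta> \<gamma> \<delta>"
    using coordinates[OF a] .
  have "a \<otimes> (\<xi> \<otimes> \<eta>) = (a \<otimes> \<xi>) \<otimes> \<eta>" using a by (simp add: m_assoc)
  also have "a \<otimes> \<xi> = \<iota> (\<epsilon> a) \<otimes> \<xi> \<oplus> \<iota> \<gamma> \<otimes> (\<xi> \<otimes> \<eta>)"
    by (subst e, subst elt_mult_X) (use a k in auto)
  also have "\<dots> \<otimes> \<eta> = \<iota> (\<epsilon> a) \<otimes> (\<xi> \<otimes> \<eta>) \<oplus> \<iota> \<gamma> \<otimes> (\<eta> \<otimes> (\<xi> \<otimes> \<eta>))"
  proof -
    have "(p \<otimes> \<xi> \<oplus> q \<otimes> (\<xi> \<otimes> \<eta>)) \<otimes> \<eta> = p \<otimes> (\<xi> \<otimes> \<eta>) \<oplus> q \<otimes> (\<eta> \<otimes> (\<xi> \<otimes> \<eta>))"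
      if "p \<in> carrier A" "q \<in> carrier A" for p q
      using that X_closed Y_closed by algebra
    then show ?thesis using a k by simp
  qed
  finally show ?thesis using a k by (simp add: XY_mult)
qed

lemma iota_unit_cancel:
  assumes "c \<in> carrier K" "c \<noteq> \<zero>\<^bsub>K\<^esub>" "a \<in> carrier A"
  shows "\<iota> (inv\<^bsub>K\<^esub> c) \<otimes> (\<iota> c \<otimes> a) = a"
proof -
  have c: "c \<in> Units K" using assms by (simp add: K.field_Units)
  then have "\<iota> (inv\<^bsub>K\<^esub> c) \<otimes> (\<iota> c \<otimes> a) = \<iota> (inv\<^bsub>K\<^esub> c \<otimes>\<^bsub>K\<^esub> c) \<otimes> a"
    using assms by (simp add: m_assoc del: K.Units_l_inv)
  then show ?thesis using c assms by simp
qed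

lemma iota_XY_eq_zero:
  assumes "c \<in> carrier K" and "\<iota> c \<otimes> (\<xi> \<otimes> \<eta>) = \<zero>"
  shows "c = \<zero>\<^bsub>K\<^esub>"
proof (rule ccontr)
  assume c: "c \<noteq> \<zero>\<^bsub>K\<^esub>"
  then have "inv\<^bsub>K\<^esub> c \<in> carrier K" using assms(1) by (simp add: K.field_Units)
  then show False
    using iota_unit_cancel[OF assms(1) c, of "\<xi> \<otimes> \<eta>"] assms(2) XY_nonzero by simp
qed

text \<open>Applying \<open>\<epsilon>\<close> and multiplying by \<open>\<eta>\<close>, then by \<open>\<xi>\<close>, isolates the first three coefficients in turn.\<close>

lemma elt_eq_zero:
  assumes k: "\<alpha> \<in> carrier K" "\<beta> \<in> carrier K" "\<gamma> \<in> carrier K" "\<delta> \<in> carrier K"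
    and z: "elt \<alpha> \<beta> \<gamma> \<delta> = \<zero>"
  shows "\<alpha> = \<zero>\<^bsub>K\<^esub>" "\<beta> = \<zero>\<^bsub>K\<^esub>" "\<gamma> = \<zero>\<^bsub>K\<^esub>" "\<delta> = \<zero>\<^bsub>K\<^esub>"
proof -
  show a: "\<alpha> = \<zero>\<^bsub>K\<^esub>" using eps_elt[OF k] z by simp
  show b: "\<beta> = \<zero>\<^bsub>K\<^esub>" using elt_mult_Y[OF k] z a k by (intro iota_XY_eq_zero) auto
  show c: "\<gamma> = \<zero>\<^bsub>K\<^esub>" using elt_mult_X[OF k] z a k by (intro iota_XY_eq_zero) auto
  show "\<delta> = \<zero>\<^bsub>K\<^esub>" using z a b c k by (intro iota_XY_eq_zero) (auto simp: elt_def)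
qed

lemma ideal_cancel:
  assumes "ideal H A" and "a \<oplus> b \<in> H" and "b \<in> H" and "a \<in> carrier A"
  shows "a \<in> H"
proof -
  interpret H: ideal H A by fact
  have "b \<in> carrier A" using assms(3) by auto
  then have "a = (a \<oplus> b) \<oplus> (\<ominus> b)" using assms(4) by algebra
  moreover have "(a \<oplus> b) \<oplus> (\<ominus> b) \<in> H"
    by (intro H.a_closed[of "a \<oplus> b"] H.a_inv_closed assms)
  ultimately show ?thesis by simp
qed

lemma ideal_scale:
  assumes "ideal H A" and "\<iota> c \<otimes> a \<in> H" and "c \<in> carrier K" "c \<noteq> \<zero>\<^bsub>K\<^esub>" "a \<in> carrier A"
  shows "a \<in> H"
proof -
  have "inv\<^bsub>K\<^esub> c \<in> carrier K" using assms by (simp add: K.field_Units)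
  then have "\<iota> (inv\<^bsub>K\<^esub> c) \<otimes> (\<iota> c \<otimes> a) \<in> H"
    by (intro ideal.I_l_closed[OF assms(1,2)]) simp
  then show ?thesis using assms by (simp add: iota_unit_cancel)
qed

text \<open>The line spanned by \<open>\<xi> \<eta>\<close> is the socle. Multiplication by \<open>\<xi> \<eta>\<close>, by \<open>\<eta>\<close>, by \<open>\<xi>\<close> or by \<open>1\<close>,
according to the first nonzero coefficient of \<open>u\<close>, yields a nonzero multiple of \<open>\<xi> \<eta>\<close>.\<close>

lemma XY_in_ideal:
  assumes H: "ideal H A" and u: "u \<in> H" "u \<noteq> \<zero>"
  shows "\<xi> \<otimes> \<eta> \<in> H"
proof -
  interpret H: ideal H A by fact
  have uc: "u \<in> carrier A" using u by auto
  obtain \<beta> \<gamma> \<delta> where k: "\<beta> \<in> carrier K" "\<gamma> \<in> carrier K" "\<delta> \<in> carrier K"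
    and e: "u = elt (\<epsilon> u) \<beta> \<gamma> \<delta>"
    using coordinates[OF uc] .
  have ek: "\<epsilon> u \<in> carrier K" using uc by simp
  consider "\<epsilon> u \<noteq> \<zero>\<^bsub>K\<^esub>" | "\<epsilon> u = \<zero>\<^bsub>K\<^esub>" "\<beta> \<noteq> \<zero>\<^bsub>K\<^esub>" | "\<epsilon> u = \<zero>\<^bsub>K\<^esub>" "\<gamma> \<noteq> \<zero>\<^bsub>K\<^esub>"
    | "\<epsilon> u = \<zero>\<^bsub>K\<^esub>" "\<beta> = \<zero>\<^bsub>K\<^esub>" "\<gamma> = \<zero>\<^bsub>K\<^esub>" by blast
  then show ?thesis
  proof cases
    case 1
    have "u \<otimes> (\<xi> \<otimes> \<eta>) \<in> H" using u by (simp add: H.I_r_closed)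
    then show ?thesis using 1 ek by - (rule ideal_scale[OF H, of "\<epsilon> u"], (auto simp: mult_XY[OF uc]))
  next
    case 2
    have "u \<otimes> \<eta> \<in> H" using u by (simp add: H.I_r_closed)
    moreover have "u \<otimes> \<eta> = \<iota> \<beta> \<otimes> (\<xi> \<otimes> \<eta>)"
      by (subst e, subst elt_mult_Y) (use 2 k in auto)
    ultimately show ?thesis using 2 k by - (rule ideal_scale[OF H, of \<beta>], auto)
  next
    case 3
    have "u \<otimes> \<xi> \<in> H" using u by (simp add: H.I_r_closed)
    moreover have "u \<otimes> \<xi> = \<iota> \<gamma> \<otimes> (\<xi> \<otimes> \<eta>)"
      by (subst e, subst elt_mult_X) (use 3 k in auto)
    ultimately show ?thesis using 3 k by - (rule ideal_scale[OF H, of \<gamma>], auto)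
  next
    case 4
    have "u = \<iota> \<delta> \<otimes> (\<xi> \<otimes> \<eta>)" by (subst e) (use 4 k in \<open>auto simp: elt_def\<close>)
    moreover from this have "\<delta> \<noteq> \<zero>\<^bsub>K\<^esub>" using u by auto
    ultimately show ?thesis using u k by - (rule ideal_scale[OF H, of \<delta>], auto)
  qed
qed

text \<open>Once \<open>\<xi> \<eta>\<close> is in \<open>H\<close>, the
products \<open>u \<xi>\<close> and \<open>u \<eta>\<close> give \<open>\<xi>\<close> and \<open>\<eta>\<close>, and subtracting these from \<open>u\<close> leaves a nonzero
scalar.\<close>

lemma ideal_eq_carrier:
  assumes H: "ideal H A" and u: "u \<in> H" "\<epsilon> u \<noteq> \<zero>\<^bsub>K\<^esub>"
  shows "H = carrier A"
proof -
  interpret H: ideal H A by fact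
  have uc: "u \<in> carrier A" using u by auto
  obtain \<beta> \<gamma> \<delta> where k: "\<beta> \<in> carrier K" "\<gamma> \<in> carrier K" "\<delta> \<in> carrier K"
    and e: "u = elt (\<epsilon> u) \<beta> \<gamma> \<delta>"
    using coordinates[OF uc] .
  have ek: "\<epsilon> u \<in> carrier K" using uc by simp
  have "u \<noteq> \<zero>" using u(2) eps.hom_zero by metis
  then have XY: "\<xi> \<otimes> \<eta> \<in> H" by (rule XY_in_ideal[OF H u(1)])
  have "u \<otimes> \<xi> \<in> H" using u by (simp add: H.I_r_closed)
  moreover have "u \<otimes> \<xi> = \<iota> (\<epsilon> u) \<otimes> \<xi> \<oplus> \<iota> \<gamma> \<otimes> (\<xi> \<otimes> \<eta>)"
    by (subst e, subst elt_mult_X) (use ek k in auto)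
  ultimately have "\<iota> (\<epsilon> u) \<otimes> \<xi> \<in> H"
    using XY ek k by - (rule ideal_cancel[OF H, of _ "\<iota> \<gamma> \<otimes> (\<xi> \<otimes> \<eta>)"], auto intro: H.I_l_closed[OF XY])
  then have X: "\<xi> \<in> H" using u ek by - (rule ideal_scale[OF H, of "\<epsilon> u"], auto)
  have "u \<otimes> \<eta> \<in> H" using u by (simp add: H.I_r_closed)
  moreover have "u \<otimes> \<eta> = \<iota> (\<epsilon> u) \<otimes> \<eta> \<oplus> \<iota> \<beta> \<otimes> (\<xi> \<otimes> \<eta>)"
    by (subst e, subst elt_mult_Y) (use ek k in auto)
  ultimately have "\<iota> (\<epsilon> u) \<otimes> \<eta> \<in> H"
    using XY ek k by - (rule ideal_cancel[OF H, of _ "\<iota> \<beta> \<otimes> (\<xi> \<otimes> \<eta>)"], auto intro: H.I_l_closed[OF XY])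
  then have Y: "\<eta> \<in> H" using u ek by - (rule ideal_scale[OF H, of "\<epsilon> u"], auto)
  have "u = \<iota> (\<epsilon> u) \<otimes> \<one> \<oplus> (\<iota> \<beta> \<otimes> \<xi> \<oplus> \<iota> \<gamma> \<otimes> \<eta> \<oplus> \<iota> \<delta> \<otimes> (\<xi> \<otimes> \<eta>))"
    using ek k by (subst e) (simp add: elt_def a_assoc)
  moreover have "\<iota> \<beta> \<otimes> \<xi> \<oplus> \<iota> \<gamma> \<otimes> \<eta> \<oplus> \<iota> \<delta> \<otimes> (\<xi> \<otimes> \<eta>) \<in> H"
    using k X Y XY by (intro H.a_closed H.I_l_closed) auto
  ultimately have "\<iota> (\<epsilon> u) \<otimes> \<one> \<in> H"
    using u ek by - (rule ideal_cancel[OF H, of _ "\<iota> \<beta> \<otimes> \<xi> \<oplus> \<iota> \<gamma> \<otimes> \<eta> \<oplus> \<iota> \<delta> \<otimes> (\<xi> \<otimes> \<eta>)"], auto)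
  then have "\<one> \<in> H" using u ek by - (rule ideal_scale[OF H, of "\<epsilon> u"], auto)
  then show ?thesis by (rule H.one_imp_carrier)
qed

abbreviation M :: "('a, 'a) module" where "M \<equiv> regular_module A"
abbreviation k :: "('a, 'k) module" where "k \<equiv> scalar_restriction K \<epsilon>"

text \<open>Annihilators inside the augmentation ideal. They provide all submodules needed below in a form in
which being an ideal is immediate: \<open>ann {}\<close> is the augmentation ideal and \<open>ann {\<xi>, \<eta>}\<close> the socle.\<close>

definition ann :: "'a set \<Rightarrow> 'a set" where
  "ann W = {a \<in> carrier A. \<epsilon> a = \<zero>\<^bsub>K\<^esub> \<and> (\<forall>w\<in>W. a \<otimes> w = \<zero>)}"

lemma ideal_ann:
  assumes "W \<subseteq> carrier A"
  shows "ideal (ann W) A"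
  using assms unfolding ideal_iff ann_def by (auto simp: l_distr m_assoc subset_iff)

lemma ann_subset: "ann W \<subseteq> carrier A"
  by (auto simp: ann_def)

lemma zero_in_ann: "W \<subseteq> carrier A \<Longrightarrow> \<zero> \<in> ann W"
  by (rule additive_subgroup.zero_closed[OF ideal.axioms(1)[OF ideal_ann]])

lemma ann_coordinates:
  assumes "a \<in> ann W"
  obtains \<beta> \<gamma> \<delta> where "\<beta> \<in> carrier K" "\<gamma> \<in> carrier K" "\<delta> \<in> carrier K"
    "a = \<iota> \<beta> \<otimes> \<xi> \<oplus> \<iota> \<gamma> \<otimes> \<eta> \<oplus> \<iota> \<delta> \<otimes> (\<xi> \<otimes> \<eta>)"
    "a \<otimes> \<xi> = \<iota> \<gamma> \<otimes> (\<xi> \<otimes> \<eta>)" "a \<otimes> \<eta> = \<iota> \<beta> \<otimes> (\<xi> \<otimes> \<eta>)"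
proof -
  have a: "a \<in> carrier A" "\<epsilon> a = \<zero>\<^bsub>K\<^esub>" using assms by (auto simp: ann_def)
  obtain \<beta> \<gamma> \<delta> where c: "\<beta> \<in> carrier K" "\<gamma> \<in> carrier K" "\<delta> \<in> carrier K"
    and e: "a = elt \<zero>\<^bsub>K\<^esub> \<beta> \<gamma> \<delta>"
    using coordinates[OF a(1)] a(2) by metis
  show thesis
  proof (rule that[OF c])
    show "a = \<iota> \<beta> \<otimes> \<xi> \<oplus> \<iota> \<gamma> \<otimes> \<eta> \<oplus> \<iota> \<delta> \<otimes> (\<xi> \<otimes> \<eta>)"
      using c by (simp add: e elt_def)
    show "a \<otimes> \<xi> = \<iota> \<gamma> \<otimes> (\<xi> \<otimes> \<eta>)" "a \<otimes> \<eta> = \<iota> \<beta> \<otimes> (\<xi> \<otimes> \<eta>)"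
      unfolding e using c by (simp_all add: elt_mult_X elt_mult_Y)
  qed
qed

lemma ann_XY: "ann {\<xi>, \<eta>} = (\<lambda>d. \<iota> d \<otimes> (\<xi> \<otimes> \<eta>)) ` carrier K"
proof (intro equalityI subsetI)
  fix a assume a: "a \<in> ann {\<xi>, \<eta>}"
  obtain \<beta> \<gamma> \<delta> where c: "\<beta> \<in> carrier K" "\<gamma> \<in> carrier K" "\<delta> \<in> carrier K"
    and e: "a = \<iota> \<beta> \<otimes> \<xi> \<oplus> \<iota> \<gamma> \<otimes> \<eta> \<oplus> \<iota> \<delta> \<otimes> (\<xi> \<otimes> \<eta>)"
    and "a \<otimes> \<xi> = \<iota> \<gamma> \<otimes> (\<xi> \<otimes> \<eta>)" "a \<otimes> \<eta> = \<iota> \<beta> \<otimes> (\<xi> \<otimes> \<eta>)"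
    using ann_coordinates[OF a] .
  then have "\<beta> = \<zero>\<^bsub>K\<^esub>" "\<gamma> = \<zero>\<^bsub>K\<^esub>"
    using a iota_XY_eq_zero[of \<beta>] iota_XY_eq_zero[of \<gamma>] by (auto simp: ann_def)
  then have "a = \<iota> \<delta> \<otimes> (\<xi> \<otimes> \<eta>)" using c by (simp add: e)
  then show "a \<in> (\<lambda>d. \<iota> d \<otimes> (\<xi> \<otimes> \<eta>)) ` carrier K" using c by blast
next
  fix a assume "a \<in> (\<lambda>d. \<iota> d \<otimes> (\<xi> \<otimes> \<eta>)) ` carrier K"
  then obtain d where d: "d \<in> carrier K" "a = \<iota> d \<otimes> (\<xi> \<otimes> \<eta>)" by blast
  have "a \<otimes> \<xi> = \<iota> d \<otimes> (\<xi> \<otimes> (\<xi> \<otimes> \<eta>))" "a \<otimes> \<eta> = \<iota> d \<otimes> (\<eta> \<otimes> (\<xi> \<otimes> \<eta>))"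
    using d by (simp_all add: m_ac)
  then show "a \<in> ann {\<xi>, \<eta>}" using d by (auto simp: ann_def XY_mult)
qed

lemma ann_XY_subset_ideal:
  assumes H: "ideal H A" "H \<noteq> {\<zero>}"
  shows "ann {\<xi>, \<eta>} \<subseteq> H"
proof -
  interpret H: ideal H A by fact
  obtain u where "u \<in> H" "u \<noteq> \<zero>" using H(2) H.zero_closed by blast
  then have "\<xi> \<otimes> \<eta> \<in> H" by (rule XY_in_ideal[OF H(1)])
  then show ?thesis unfolding ann_XY using H.I_l_closed by auto
qed

lemma proper_ideal_subset:
  assumes "ideal H A" "H \<noteq> carrier A"
  shows "H \<subseteq> ann {}"
  using assms ideal_eq_carrier[OF assms(1)] ideal.Icarr[OF assms(1)] by (auto simp: ann_def)

section \<open>Radicals of the regular module\<close>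

lemma maximal_submodule_regular_iff:
  assumes "ideal N A"
  shows "maximal_submodule L A (M\<lparr>carrier := N\<rparr>) \<longleftrightarrow> ideal L A \<and> L \<subseteq> N \<and> L \<noteq> N
    \<and> (\<forall>H. ideal H A \<and> H \<subseteq> N \<and> L \<subseteq> H \<longrightarrow> H = L \<or> H = N)"
  unfolding maximal_submodule_def submodule_regular_iff[OF A.is_cring assms] by auto

lemma X_Y_in_ann: "\<xi> \<notin> ann {\<xi>, \<eta>}"  "\<xi> \<in> ann {\<xi>}" "\<eta> \<notin> ann {\<xi>}" "\<eta> \<in> ann {\<eta>}" "\<xi> \<notin> ann {\<eta>}"
  "\<xi> \<in> ann {}" "\<eta> \<in> ann {}"
  using XY_nonzero X_sq Y_sq by (auto simp: ann_def m_comm)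

lemma ann_mono: "V \<subseteq> W \<Longrightarrow> ann W \<subseteq> ann V"
  by (auto simp: ann_def)

lemma one_notin_ann: "\<one> \<notin> ann W"
  by (simp add: ann_def)

text \<open>An ideal other than \<open>A\<close> lies in the augmentation ideal, which is therefore the only maximal submodule.\<close>

lemma rad_regular: "rad A (M\<lparr>carrier := carrier A\<rparr>) = ann {}"
proof -
  have "maximal_submodule L A (M\<lparr>carrier := carrier A\<rparr>) \<longleftrightarrow> L = ann {}" for L
    unfolding maximal_submodule_regular_iff[OF A.oneideal]
  proof (intro iffI)
    assume L: "ideal L A \<and> L \<subseteq> carrier A \<and> L \<noteq> carrier A \<and>
      (\<forall>H. ideal H A \<and> H \<subseteq> carrier A \<and> L \<subseteq> H \<longrightarrow> H = L \<or> H = carrier A)"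
    have "ann {} \<noteq> carrier A" using one_closed one_notin_ann by blast
    moreover have "L \<subseteq> ann {}" using L proper_ideal_subset by blast
    moreover have "ideal (ann {}) A" "ann {} \<subseteq> carrier A" by (simp_all add: ideal_ann ann_subset)
    ultimately show "L = ann {}" using L by blast
  next
    assume L: "L = ann {}"
    have "ann {} \<noteq> carrier A" using one_closed one_notin_ann by blast
    then show "ideal L A \<and> L \<subseteq> carrier A \<and> L \<noteq> carrier A \<and>
      (\<forall>H. ideal H A \<and> H \<subseteq> carrier A \<and> L \<subseteq> H \<longrightarrow> H = L \<or> H = carrier A)"
      using proper_ideal_subset ideal_ann[of "{}"] ann_subset unfolding L by blast
  qed
  then show ?thesis using ann_subset by (auto simp: rad_def)
qed

text \<open>Here \<open>ann {\<xi>}\<close> is spanned by \<open>\<xi>\<close> and \<open>\<xi> \<eta>\<close>; an element of \<open>ann {}\<close> outside it has a nonzero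
coefficient at \<open>\<eta>\<close>, and this brings \<open>\<eta>\<close> into every larger ideal.\<close>

lemma maximal_ann_X: "maximal_submodule (ann {\<xi>}) A (M\<lparr>carrier := ann {}\<rparr>)"
proof -
  have "H = ann {}" if H: "ideal H A" "H \<subseteq> ann {}" "ann {\<xi>} \<subseteq> H" "H \<noteq> ann {\<xi>}" for H
  proof -
    interpret H: ideal H A by fact
    obtain u where u: "u \<in> H" "u \<notin> ann {\<xi>}" using H by blast
    have u0: "u \<in> ann {}" using u H by blast
    obtain \<beta> \<gamma> \<delta> where c: "\<beta> \<in> carrier K" "\<gamma> \<in> carrier K" "\<delta> \<in> carrier K"
      and e: "u = \<iota> \<beta> \<otimes> \<xi> \<oplus> \<iota> \<gamma> \<otimes> \<eta> \<oplus> \<iota> \<delta> \<otimes> (\<xi> \<otimes> \<eta>)"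
      and uX: "u \<otimes> \<xi> = \<iota> \<gamma> \<otimes> (\<xi> \<otimes> \<eta>)"
      using ann_coordinates[OF u0] by metis
    have \<gamma>: "\<gamma> \<noteq> \<zero>\<^bsub>K\<^esub>" using u(2) u0 uX by (auto simp: ann_def)
    have X: "\<xi> \<in> H" using H(3) X_Y_in_ann by blast
    have XY: "\<xi> \<otimes> \<eta> \<in> H" using X by (simp add: H.I_r_closed)
    have "u = \<iota> \<gamma> \<otimes> \<eta> \<oplus> (\<iota> \<beta> \<otimes> \<xi> \<oplus> \<iota> \<delta> \<otimes> (\<xi> \<otimes> \<eta>))"
      using c by (simp add: e a_ac)
    then have **: "\<iota> \<gamma> \<otimes> \<eta> \<oplus> (\<iota> \<beta> \<otimes> \<xi> \<oplus> \<iota> \<delta> \<otimes> (\<xi> \<otimes> \<eta>)) \<in> H"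
      using u(1) by (simp only:)
    have *: "\<iota> \<beta> \<otimes> \<xi> \<oplus> \<iota> \<delta> \<otimes> (\<xi> \<otimes> \<eta>) \<in> H"
      using c by (intro H.a_closed H.I_l_closed[OF XY] H.I_l_closed[OF X]) auto
    have "\<iota> \<gamma> \<otimes> \<eta> \<in> H"
      by (rule ideal_cancel[OF H(1) ** *]) (use c in simp)
    then have Y: "\<eta> \<in> H" using c \<gamma> by - (rule ideal_scale[OF H(1), of \<gamma>], auto)
    have "a \<in> H" if a: "a \<in> ann {}" for a
    proof -
      obtain \<beta> \<gamma> \<delta> where c: "\<beta> \<in> carrier K" "\<gamma> \<in> carrier K" "\<delta> \<in> carrier K"
        and e: "a = \<iota> \<beta> \<otimes> \<xi> \<oplus> \<iota> \<gamma> \<otimes> \<eta> \<oplus> \<iota> \<delta> \<otimes> (\<xi> \<otimes> \<eta>)"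
        using ann_coordinates[OF a] by metis
      show ?thesis unfolding e
        using c by (intro H.a_closed H.I_l_closed[OF XY] H.I_l_closed[OF X] H.I_l_closed[OF Y]) auto
    qed
    then show ?thesis using H(2) by blast
  qed
  moreover have "ann {\<xi>} \<noteq> ann {}" using X_Y_in_ann by blast
  moreover have "ann {\<xi>} \<subseteq> ann {}" by (rule ann_mono) simp
  moreover have "ideal (ann {\<xi>}) A" "ideal (ann {}) A" by (simp_all add: ideal_ann)
  ultimately show ?thesis by (subst maximal_submodule_regular_iff) blast+
qed

text \<open>The assumptions are symmetric in \<open>\<xi>\<close> and \<open>\<eta>\<close>; this transfers \<open>maximal_ann_X\<close> to \<open>\<eta>\<close>.\<close>

lemma exchange_X_Y: "square_zero_algebra A K \<iota> \<epsilon> \<eta> \<xi>"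
proof -
  have "\<exists>\<alpha>\<in>carrier K. \<exists>\<beta>\<in>carrier K. \<exists>\<gamma>\<in>carrier K. \<exists>\<delta>\<in>carrier K.
      a = \<iota> \<alpha> \<oplus> \<iota> \<beta> \<otimes> \<eta> \<oplus> \<iota> \<gamma> \<otimes> \<xi> \<oplus> \<iota> \<delta> \<otimes> (\<eta> \<otimes> \<xi>)" if a: "a \<in> carrier A" for a
  proof -
    obtain \<alpha> \<beta> \<gamma> \<delta> where c: "\<alpha> \<in> carrier K" "\<beta> \<in> carrier K" "\<gamma> \<in> carrier K" "\<delta> \<in> carrier K"
      and e: "a = \<iota> \<alpha> \<oplus> \<iota> \<beta> \<otimes> \<xi> \<oplus> \<iota> \<gamma> \<otimes> \<eta> \<oplus> \<iota> \<delta> \<otimes> (\<xi> \<otimes> \<eta>)"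
      using span[OF a] by blast
    have "a = \<iota> \<alpha> \<oplus> \<iota> \<gamma> \<otimes> \<eta> \<oplus> \<iota> \<beta> \<otimes> \<xi> \<oplus> \<iota> \<delta> \<otimes> (\<eta> \<otimes> \<xi>)"
      using c by (simp add: e a_ac m_comm)
    then show ?thesis using c by blast
  qed
  then show ?thesis
    using X_sq Y_sq XY_nonzero iota_hom eps_hom
    by unfold_locales (auto simp: m_comm)
qed

lemma maximal_ann_Y: "maximal_submodule (ann {\<eta>}) A (M\<lparr>carrier := ann {}\<rparr>)"
proof -
  interpret swap: square_zero_algebra A K \<iota> \<epsilon> \<eta> \<xi> by (rule exchange_X_Y)
  show ?thesis using swap.maximal_ann_X unfolding swap.ann_def ann_def .
qed

text \<open>The two maximal submodules \<open>ann {\<xi>}\<close> and \<open>ann {\<eta>}\<close> bound the radical from above. From below, the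
socle lies in every nonzero ideal, and the zero ideal is not maximal in \<open>ann {}\<close> because the
socle lies strictly in between.\<close>

lemma rad_ann: "rad A (M\<lparr>carrier := ann {}\<rparr>) = ann {\<xi>, \<eta>}"
proof
  show "rad A (M\<lparr>carrier := ann {}\<rparr>) \<subseteq> ann {\<xi>, \<eta>}"
    using maximal_ann_X maximal_ann_Y by (force simp: rad_def ann_def)
  have "ann {\<xi>, \<eta>} \<subseteq> L" if L: "maximal_submodule L A (M\<lparr>carrier := ann {}\<rparr>)" for L
  proof (cases "L = {\<zero>}")
    case True
    have "ideal (ann {\<xi>, \<eta>}) A" "ann {\<xi>, \<eta>} \<subseteq> ann {}" "L \<subseteq> ann {\<xi>, \<eta>}"
      using zero_in_ann[of "{\<xi>, \<eta>}"] by (simp_all add: ideal_ann ann_mono True)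
    then have "ann {\<xi>, \<eta>} = L \<or> ann {\<xi>, \<eta>} = ann {}"
      using L maximal_submodule_regular_iff[OF ideal_ann[of "{}"]] by blast
    then show ?thesis using X_Y_in_ann by blast
  next
    case False
    have "ideal L A" using L by (simp add: maximal_submodule_regular_iff ideal_ann)
    then show ?thesis using False by (rule ann_XY_subset_ideal)
  qed
  then show "ann {\<xi>, \<eta>} \<subseteq> rad A (M\<lparr>carrier := ann {}\<rparr>)"
    using ann_mono[of "{}" "{\<xi>, \<eta>}"] by (auto simp: rad_def)
qed

lemma XY_in_ann: "\<xi> \<otimes> \<eta> \<in> ann {\<xi>, \<eta>}"
  unfolding ann_XY by (rule image_eqI[of _ _ "\<one>\<^bsub>K\<^esub>"]) auto

lemma rad_ann_XY: "rad A (M\<lparr>carrier := ann {\<xi>, \<eta>}\<rparr>) = {\<zero>}"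
proof -
  have "maximal_submodule {\<zero>} A (M\<lparr>carrier := ann {\<xi>, \<eta>}\<rparr>)"
    using XY_in_ann XY_nonzero ann_XY_subset_ideal A.zeroideal zero_in_ann
    by (auto simp: maximal_submodule_regular_iff ideal_ann)
  moreover have "\<zero> \<in> L" if "maximal_submodule L A (M\<lparr>carrier := ann {\<xi>, \<eta>}\<rparr>)" for L
    using that additive_subgroup.zero_closed[OF ideal.axioms(1)]
    by (auto simp: maximal_submodule_regular_iff ideal_ann)
  ultimately show ?thesis
    using zero_in_ann[of "{\<xi>, \<eta>}"] by (auto simp: rad_def)
qed

lemma rad_pow_regular:
  "rad_pow A M 1 = ann {}" "rad_pow A M 2 = ann {\<xi>, \<eta>}" "rad_pow A M 3 = {\<zero>}"
  by (simp_all add: numeral_eq_Suc rad_regular rad_ann rad_ann_XY)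

section \<open>Radical layers\<close>

lemma module_k: "module A k"
  by (rule module_scalar_restriction[OF A.is_cring K.is_cring eps_hom])

text \<open>The coordinate on the line \<open>K \<xi> \<eta>\<close>. The other coordinates used below are \<open>socle_coord (a \<eta>)\<close> and
\<open>socle_coord (a \<xi>)\<close>, which for \<open>a\<close> in the augmentation ideal are the coefficients of \<open>\<xi>\<close> and \<open>\<eta>\<close>.\<close>

definition socle_coord :: "'a \<Rightarrow> 'k" where
  "socle_coord = inv_into (carrier K) (\<lambda>d. \<iota> d \<otimes> (\<xi> \<otimes> \<eta>))"

lemma inj_socle: "inj_on (\<lambda>d. \<iota> d \<otimes> (\<xi> \<otimes> \<eta>)) (carrier K)"
proof (rule inj_onI)
  fix c d assume cd: "c \<in> carrier K" "d \<in> carrier K"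
    and eq: "\<iota> c \<otimes> (\<xi> \<otimes> \<eta>) = \<iota> d \<otimes> (\<xi> \<otimes> \<eta>)"
  have "\<iota> (c \<ominus>\<^bsub>K\<^esub> d) \<otimes> (\<xi> \<otimes> \<eta>) = \<iota> c \<otimes> (\<xi> \<otimes> \<eta>) \<ominus> \<iota> d \<otimes> (\<xi> \<otimes> \<eta>)"
    using cd by (simp add: K.minus_eq minus_eq l_distr l_minus)
  also have "\<dots> = \<zero>" using cd by (simp add: eq minus_eq r_neg)
  finally have "c \<ominus>\<^bsub>K\<^esub> d = \<zero>\<^bsub>K\<^esub>" using cd by (intro iota_XY_eq_zero) auto
  then show "c = d" using cd by simp
qed

lemma socle_coord_iota [simp]: "d \<in> carrier K \<Longrightarrow> socle_coord (\<iota> d \<otimes> (\<xi> \<otimes> \<eta>)) = d"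
  unfolding socle_coord_def by (rule inv_into_f_f[OF inj_socle])

lemma socle_coord_closed: "a \<in> ann {\<xi>, \<eta>} \<Longrightarrow> socle_coord a \<in> carrier K"
  by (auto simp: ann_XY)

lemma socle_coord_add:
  "\<lbrakk>a \<in> ann {\<xi>, \<eta>}; b \<in> ann {\<xi>, \<eta>}\<rbrakk> \<Longrightarrow> socle_coord (a \<oplus> b) = socle_coord a \<oplus>\<^bsub>K\<^esub> socle_coord b"
  by (auto simp: ann_XY simp flip: l_distr iota.hom_add)

text \<open>The ring acts on the socle through \<open>\<epsilon>\<close>, since \<open>\<xi>\<close> and \<open>\<eta>\<close> annihilate it.\<close>

lemma socle_coord_mult:
  assumes "r \<in> carrier A" "a \<in> ann {\<xi>, \<eta>}"
  shows "socle_coord (r \<otimes> a) = \<epsilon> r \<otimes>\<^bsub>K\<^esub> socle_coord a"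
proof -
  obtain d where d: "d \<in> carrier K" "a = \<iota> d \<otimes> (\<xi> \<otimes> \<eta>)" using assms(2) by (auto simp: ann_XY)
  have "r \<otimes> a = \<iota> d \<otimes> (r \<otimes> (\<xi> \<otimes> \<eta>))" using assms(1) d by (simp add: m_ac)
  also have "\<dots> = \<iota> d \<otimes> (\<iota> (\<epsilon> r) \<otimes> (\<xi> \<otimes> \<eta>))" by (simp only: mult_XY[OF assms(1)])
  also have "\<dots> = \<iota> (\<epsilon> r \<otimes>\<^bsub>K\<^esub> d) \<otimes> (\<xi> \<otimes> \<eta>)" using assms(1) d by (simp add: m_ac)
  finally have e: "r \<otimes> a = \<iota> (\<epsilon> r \<otimes>\<^bsub>K\<^esub> d) \<otimes> (\<xi> \<otimes> \<eta>)" .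
  have "socle_coord (r \<otimes> a) = \<epsilon> r \<otimes>\<^bsub>K\<^esub> d"
    unfolding e using assms(1) d(1) by (intro socle_coord_iota) simp
  moreover have "socle_coord a = d" unfolding d(2) using d(1) by simp
  ultimately show ?thesis by simp
qed

lemma socle_coord_eq_zero:
  "a \<in> ann {\<xi>, \<eta>} \<Longrightarrow> socle_coord a = \<zero>\<^bsub>K\<^esub> \<longleftrightarrow> a = \<zero>"
  using socle_coord_iota[OF K.zero_closed] by (auto simp: ann_XY)

lemma ann_mult_XY:
  assumes "a \<in> ann {}"
  shows "a \<otimes> \<xi> \<in> ann {\<xi>, \<eta>}" "a \<otimes> \<eta> \<in> ann {\<xi>, \<eta>}"
  using ann_coordinates[OF assms] unfolding ann_XY by blast+

lemma layer_top: "modules_isomorphic A (radical_layer A M 1) k"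
  unfolding radical_layer_def rad_pow_regular diff_self_eq_0 rad_pow.simps regular_module_simps
proof (rule modules_isomorphic_quotient[where f = \<epsilon>])
  show "module A (M\<lparr>carrier := carrier A\<rparr>)" by (rule module_ideal[OF A.is_cring A.oneideal])
  show "\<epsilon> \<in> module_hom A (M\<lparr>carrier := carrier A\<rparr>) k" by (auto simp: module_hom_def)
  have "c \<in> \<epsilon> ` carrier A" if "c \<in> carrier K" for c
    using that by (intro image_eqI[of _ _ "\<iota> c"]) auto
  then show "\<epsilon> ` carrier (M\<lparr>carrier := carrier A\<rparr>) = carrier k" by auto
qed (auto simp: module_k ann_def)

lemma layer_middle: "modules_isomorphic A (radical_layer A M 2) (direct_sum_module k k)"
proof -
  let ?f = "\<lambda>a. (socle_coord (a \<otimes> \<eta>), socle_coord (a \<otimes> \<xi>))"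
  have "modules_isomorphic A (quotient_module (M\<lparr>carrier := ann {}\<rparr>) (ann {\<xi>, \<eta>})) (direct_sum_module k k)"
  proof (rule modules_isomorphic_quotient[where f = ?f])
    show "module A (M\<lparr>carrier := ann {}\<rparr>)" by (rule module_ideal[OF A.is_cring ideal_ann]) simp
    show "module A (direct_sum_module k k)" by (rule module_direct_sum[OF module_k module_k])
    have ac: "a \<in> carrier A" if "a \<in> ann {}" for a using that ann_subset by blast
    show "?f \<in> module_hom A (M\<lparr>carrier := ann {}\<rparr>) (direct_sum_module k k)"
      by (auto simp: module_hom_def ac ann_mult_XY l_distr m_assoc socle_coord_closed
          socle_coord_add socle_coord_mult)
    have "(b, c) \<in> ?f ` ann {}" if bc: "b \<in> carrier K" "c \<in> carrier K" for b c
    proof (rule image_eqI)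
      have e: "\<iota> b \<otimes> \<xi> \<oplus> \<iota> c \<otimes> \<eta> = elt \<zero>\<^bsub>K\<^esub> b c \<zero>\<^bsub>K\<^esub>" using bc by (simp add: elt_def)
      show "\<iota> b \<otimes> \<xi> \<oplus> \<iota> c \<otimes> \<eta> \<in> ann {}" using bc by (simp add: ann_def)
      show "(b, c) = ?f (\<iota> b \<otimes> \<xi> \<oplus> \<iota> c \<otimes> \<eta>)"
        unfolding e using bc by (simp add: elt_mult_X elt_mult_Y)
    qed
    then show "?f ` carrier (M\<lparr>carrier := ann {}\<rparr>) = carrier (direct_sum_module k k)"
      using ann_mult_XY socle_coord_closed by auto
    show "ann {\<xi>, \<eta>} = {m \<in> carrier (M\<lparr>carrier := ann {}\<rparr>). ?f m = \<zero>\<^bsub>direct_sum_module k k\<^esub>}"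
    proof -
      have "?f m = (\<zero>\<^bsub>K\<^esub>, \<zero>\<^bsub>K\<^esub>) \<longleftrightarrow> m \<otimes> \<eta> = \<zero> \<and> m \<otimes> \<xi> = \<zero>" if "m \<in> ann {}" for m
        using that by (simp add: socle_coord_eq_zero ann_mult_XY)
      then show ?thesis by (simp only: direct_sum_module_simps scalar_restriction_simps)
          (auto simp: ann_def)
    qed
  qed
  then show ?thesis using rad_pow_regular by (simp add: radical_layer_def)
qed

lemma layer_bottom: "modules_isomorphic A (radical_layer A M 3) k"
proof -
  have "modules_isomorphic A (quotient_module (M\<lparr>carrier := ann {\<xi>, \<eta>}\<rparr>) {\<zero>}) k"
  proof (rule modules_isomorphic_quotient[where f = socle_coord])
    show "module A (M\<lparr>carrier := ann {\<xi>, \<eta>}\<rparr>)"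
      by (rule module_ideal[OF A.is_cring ideal_ann]) simp
    show "socle_coord \<in> module_hom A (M\<lparr>carrier := ann {\<xi>, \<eta>}\<rparr>) k"
      by (auto simp: module_hom_def socle_coord_closed socle_coord_add socle_coord_mult)
    show "socle_coord ` carrier (M\<lparr>carrier := ann {\<xi>, \<eta>}\<rparr>) = carrier k"
      by (simp add: ann_XY image_image)
    show "{\<zero>} = {m \<in> carrier (M\<lparr>carrier := ann {\<xi>, \<eta>}\<rparr>). socle_coord m = \<zero>\<^bsub>k\<^esub>}"
      using zero_in_ann[of "{\<xi>, \<eta>}"] by (auto simp: socle_coord_eq_zero)
  qed (rule module_k)
  then show ?thesis using rad_pow_regular by (simp add: radical_layer_def)
qed

section \<open>The regular module as a projective indecomposable module\<close>

lemma submodule_iff_ideal: "submodule H A M \<longleftrightarrow> ideal H A"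
  using submodule_regular_iff[OF A.is_cring A.oneideal, of H] ideal.Icarr[of H A]
  by (auto simp: regular_module_def)

lemma carrier_nontrivial: "carrier A \<noteq> {\<zero>}"
  using m_closed[OF X_closed Y_closed] XY_nonzero by blast

text \<open>Any two nonzero submodules share the socle, so the module cannot split.\<close>

lemma projective_indecomposable_regular:
  "projective_indecomposable TYPE('m) TYPE('n) A M"
proof -
  have "U = {\<zero>} \<or> V = {\<zero>}" if "ideal U A" "ideal V A" "U \<inter> V = {\<zero>}" for U V
  proof (rule ccontr)
    assume "\<not> (U = {\<zero>} \<or> V = {\<zero>})"
    then have "ann {\<xi>, \<eta>} \<subseteq> U \<inter> V" using that ann_XY_subset_ideal by blast
    then show False using XY_in_ann XY_nonzero that(3) by blast
  qed
  moreover note carrier_nontrivial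
  ultimately have "indecomposable_module A M"
    by (auto simp: indecomposable_module_def module_regular A.is_cring submodule_iff_ideal)
  then show ?thesis
    unfolding projective_indecomposable_def
    using fg_module_regular[OF A.is_cring] projective_module_regular[OF A.is_cring] by blast
qed

text \<open>The kernel of \<open>\<epsilon>\<close> is superfluous: a submodule that maps onto \<open>K\<close> contains an element of augmentation \<open>1\<close>.\<close>

lemma projective_cover_regular:
  "projective_cover TYPE('m) TYPE('n) A M \<epsilon> k"
proof -
  have surj: "\<epsilon> ` carrier A = carrier K"
    using image_eqI[of _ \<epsilon> "\<iota> _"] by force
  have "fg_module A k"
    unfolding fg_module_def
  proof (intro conjI exI[of _ "{\<one>\<^bsub>K\<^esub>}"] allI impI module_k)
    fix H assume H: "submodule H A k \<and> {\<one>\<^bsub>K\<^esub>} \<subseteq> H"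
    have "c \<in> H" if "c \<in> carrier K" for c
      using H that iota.hom_closed[OF that] submodule_iff[OF module_k, of H]
      by (auto dest!: bspec[of _ _ "\<iota> c"])
    then show "H = carrier k" using H submodule_iff[OF module_k, of H] by auto
  qed auto
  moreover have "H = carrier A" if H: "ideal H A" "\<epsilon> ` H = carrier K" for H
  proof -
    obtain u where "u \<in> H" "\<epsilon> u = \<one>\<^bsub>K\<^esub>" using H(2) K.one_closed by (metis imageE)
    then show ?thesis using ideal_eq_carrier[OF H(1)] by simp
  qed
  moreover have "\<epsilon> \<in> module_hom A M k" by (auto simp: module_hom_def)
  ultimately show ?thesis
    unfolding projective_cover_def
    using fg_module_regular[OF A.is_cring] projective_module_regular[OF A.is_cring] surj
    by (simp add: submodule_iff_ideal)
qed

text \<open>With two or more summands, all of them nonzero, \<open>\<xi> \<eta>\<close> could be written both as an element of the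
first and as an element of the second summand, against uniqueness.\<close>

lemma pim_decomposition_regular_iff:
  "pim_decomposition TYPE('m) TYPE('n) A M n U \<longleftrightarrow> n = 1 \<and> U 0 = carrier A"
proof
  assume D: "pim_decomposition TYPE('m) TYPE('n) A M n U"
  let ?s = "\<lambda>u. \<Oplus>i\<in>{..<n}. u i"
  have ideals: "ideal (U i) A" "U i \<noteq> {\<zero>}" if "i < n" for i
    using D that by (auto simp: pim_decomposition_def internal_direct_sum_def submodule_iff_ideal
        projective_indecomposable_def indecomposable_module_def)
  have bij: "bij_betw ?s (Pi\<^sub>E {..<n} U) (carrier A)"
    using D by (simp add: pim_decomposition_def internal_direct_sum_def finsum_regular_module)
  have "n \<noteq> 0"
  proof
    assume "n = 0"
    then have "carrier A = {\<zero>}" using bij by (simp add: bij_betw_def)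
    then show False using carrier_nontrivial by blast
  qed
  moreover have "\<not> 2 \<le> n"
  proof
    assume n: "2 \<le> n"
    let ?e = "\<lambda>j. \<lambda>i\<in>{..<n}. if i = j then \<xi> \<otimes> \<eta> else \<zero>"
    have e: "?e j \<in> Pi\<^sub>E {..<n} U" if "j < n" for j
      using ideals[OF that] ann_XY_subset_ideal[of "U j"] XY_in_ann
        additive_subgroup.zero_closed[OF ideal.axioms(1)[OF ideals(1)]]
      by (auto simp: PiE_iff)
    have s: "?s (?e j) = \<xi> \<otimes> \<eta>" if "j < n" for j
    proof -
      have "?s (?e j) = (\<Oplus>i\<in>{..<n}. if j = i then \<xi> \<otimes> \<eta> else \<zero>)"
        by (rule finsum_cong') auto
      then show ?thesis using that finsum_singleton[of j "{..<n}" "\<lambda>_. \<xi> \<otimes> \<eta>"] by simp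
    qed
    have "?e 0 = ?e 1"
      using bij_betw_imp_inj_on[OF bij] e[of 0] e[of 1] s[of 0] s[of 1] n
      by (intro inj_onD[of ?s "Pi\<^sub>E {..<n} U"]) auto
    then have "?e 0 0 = ?e 1 0" by (rule fun_cong)
    then show False using n XY_nonzero by simp
  qed
  ultimately have n: "n = 1" by simp
  have "carrier A = ?s ` (Pi\<^sub>E {..<n} U)" using bij by (simp add: bij_betw_def)
  also have "\<dots> \<subseteq> U 0"
    using ideals[of 0] by (auto simp: n PiE_iff lessThan_Suc ideal.Icarr)
  finally show "n = 1 \<and> U 0 = carrier A" using n ideals[of 0] ideal.Icarr by fastforce
next
  assume nU: "n = 1 \<and> U 0 = carrier A"
  have "bij_betw (\<lambda>u. \<Oplus>i\<in>{..<1::nat}. u i) (Pi\<^sub>E {..<1} U) (carrier A)"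
  proof (rule bij_betw_byWitness[where f' = "\<lambda>a. \<lambda>i\<in>{..<1::nat}. a"])
    have s: "(\<Oplus>i\<in>{..<1::nat}. u i) = u 0" if "u 0 \<in> carrier A" for u
      using that by (simp add: lessThan_Suc)
    have c: "u 0 \<in> carrier A" if "u \<in> Pi\<^sub>E {..<1} U" for u
      using PiE_mem[OF that, of 0] nU by simp
    show "\<forall>u\<in>Pi\<^sub>E {..<1} U. (\<lambda>i\<in>{..<1}. \<Oplus>i\<in>{..<1}. u i) = u"
      using s c by (auto simp: fun_eq_iff PiE_iff extensional_def)
    show "\<forall>a\<in>carrier A. (\<Oplus>i\<in>{..<1::nat}. (\<lambda>i\<in>{..<1}. a) i) = a"
      by (intro ballI, subst s) simp_all
    show "(\<lambda>u. \<Oplus>i\<in>{..<1::nat}. u i) ` Pi\<^sub>E {..<1} U \<subseteq> carrier A"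
      using s c by auto
    show "(\<lambda>a. \<lambda>i\<in>{..<1::nat}. a) ` carrier A \<subseteq> Pi\<^sub>E {..<1} U"
    proof (intro image_subsetI PiE_I)
      fix a and i :: nat assume "a \<in> carrier A" "i \<in> {..<1}"
      then show "(\<lambda>i\<in>{..<1}. a) i \<in> U i" using nU by simp
    qed simp
  qed
  moreover have "M\<lparr>carrier := carrier A\<rparr> = M" by (simp add: regular_module_def)
  then have "projective_indecomposable TYPE('m) TYPE('n) A (M\<lparr>carrier := carrier A\<rparr>)"
    by (simp only: projective_indecomposable_regular)
  ultimately show "pim_decomposition TYPE('m) TYPE('n) A M n U"
    using nU A.oneideal
    by (simp add: pim_decomposition_def internal_direct_sum_def finsum_regular_module
        submodule_iff_ideal)
qed

end

section \<open>Presentation by generators and relations\<close>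

text \<open>One step of division by the variable; the quotient is the shifted coefficient sequence. It serves
in place of a full expansion into monomials, because only degrees up to one survive modulo the squares.\<close>

lemma (in UP_cring) constant_plus_X_multiple:
  assumes p: "p \<in> carrier P"
  shows "\<exists>c\<in>carrier R. \<exists>q\<in>carrier P. p = up_ring.monom P c 0 \<oplus>\<^bsub>P\<^esub> up_ring.monom P \<one> 1 \<otimes>\<^bsub>P\<^esub> q"
proof -
  let ?q = "\<lambda>n. p (Suc n)"
  have pu: "p \<in> up R" using p by (simp add: P_def UP_def)
  then obtain n where "bound \<zero> n p" by auto
  then have "bound \<zero> n ?q" by (auto simp: bound_def)
  then have qu: "?q \<in> up R" using pu by auto
  have carr: "carrier P = up R" unfolding P_def UP_def by simp
  have coeff_P: "up_ring.coeff P f = f" if "f \<in> up R" for f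
    using that unfolding P_def UP_def by simp_all
  have q: "?q \<in> carrier P" using qu unfolding carr .
  have cq: "up_ring.coeff P ?q n = p (Suc n)" for n by (simp only: coeff_P[OF qu])
  have cp: "up_ring.coeff P p n = p n" for n by (simp only: coeff_P[OF pu])
  have p0: "p n \<in> carrier R" for n using pu by auto
  have "p = up_ring.monom P (p 0) 0 \<oplus>\<^bsub>P\<^esub> up_ring.monom P \<one> 1 \<otimes>\<^bsub>P\<^esub> ?q"
  proof (rule up_eqI)
    fix n
    show "up_ring.coeff P p n = up_ring.coeff P (up_ring.monom P (p 0) 0 \<oplus>\<^bsub>P\<^esub> up_ring.monom P \<one> 1 \<otimes>\<^bsub>P\<^esub> ?q) n"
    proof (cases n)
      case 0
      then show ?thesis using q by (simp add: p0 cp)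
    next
      case (Suc m)
      then show ?thesis
        using q coeff_monom_mult[OF R.one_closed q, of 1 m]
        by (simp add: p0 cp cq del: coeff_mult)
    qed
  qed (use p q p0 in auto)
  then show ?thesis using p0 q by blast
qed

context square_zero_algebra
begin

text \<open>The isomorphism is the inverse of the map induced by evaluation at \<open>(\<xi>, \<eta>)\<close>. Evaluation is done
one variable at a time, since \<open>K[X, Y]\<close> is \<open>K[X][Y]\<close>.\<close>

theorem quotient_presentation:
  "\<exists>\<phi>\<in>ring_iso A (poly2 K Quot ideal_X2_Y2 K).
    (\<forall>c\<in>carrier K. \<phi> (\<iota> c) = ideal_X2_Y2 K +>\<^bsub>poly2 K\<^esub> poly2_const K c)
    \<and> \<phi> \<xi> = ideal_X2_Y2 K +>\<^bsub>poly2 K\<^esub> poly2_X K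
    \<and> \<phi> \<eta> = ideal_X2_Y2 K +>\<^bsub>poly2 K\<^esub> poly2_Y K"
proof -
  define B where "B = UP K"
  define P where "P = UP B"
  define C where "C = poly2_const K"
  define x where "x = poly2_X K"
  define y where "y = poly2_Y K"
  define I where "I = ideal_X2_Y2 K"
  have P2: "poly2 K = P" by (simp add: P_def B_def)
  interpret B: UP_cring K B
    by (rule UP_cring.intro) (simp_all add: B_def K.is_cring)
  interpret P: UP_cring B P
    by (rule UP_cring.intro) (simp_all add: P_def B.UP_cring)
  interpret e1: UP_pre_univ_prop K A \<iota> B ..
  define E1 where "E1 = UnivPoly.eval K A \<iota> \<xi>"
  have "E1 \<in> ring_hom B A" unfolding E1_def by (rule e1.eval_ring_hom) simp
  then interpret E1: ring_hom_cring B A E1 by unfold_locales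
  interpret e2: UP_pre_univ_prop B A E1 P ..
  define E where "E = UnivPoly.eval B A E1 \<eta>"
  have "E \<in> ring_hom P A" unfolding E_def by (rule e2.eval_ring_hom) simp
  then interpret E: ring_hom_cring P A E by unfold_locales
  have E_ring_hom: "ring_hom_ring P A E"
    by (intro ring_hom_ringI2 P.P.ring_axioms A.ring_axioms \<open>E \<in> ring_hom P A\<close>)

  let ?c = "\<lambda>p. up_ring.monom P p 0"
  have c_hom: "?c \<in> ring_hom B P" by (rule P.const_ring_hom)
  interpret c: ring_hom_cring B P ?c by unfold_locales (rule c_hom)
  have C: "C a = ?c (up_ring.monom B a 0)" for a
    by (simp add: C_def poly2_const_def P_def B_def)
  have x: "x = ?c (up_ring.monom B \<one>\<^bsub>K\<^esub> 1)"
    by (simp add: x_def poly2_X_def P_def B_def)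
  have y: "y = up_ring.monom P \<one>\<^bsub>B\<^esub> 1"
    by (simp add: y_def poly2_Y_def P_def B_def)
  have C_closed [simp]: "C a \<in> carrier P" if "a \<in> carrier K" for a
    unfolding C using that by simp
  have x_closed [simp]: "x \<in> carrier P" unfolding x by simp
  have y_closed [simp]: "y \<in> carrier P" unfolding y by simp
  have E_c: "E (?c p) = E1 p" if "p \<in> carrier B" for p
    unfolding E_def using that by (intro e2.eval_const) auto
  have E_C [simp]: "E (C a) = \<iota> a" if "a \<in> carrier K" for a
    unfolding C using that by (simp add: E_c E1_def e1.eval_const)
  have E_x [simp]: "E x = \<xi>"
    unfolding x by (subst E_c) (simp_all add: E1_def e1.eval_monom1 del: One_nat_def)
  have E_y [simp]: "E y = \<eta>"
    unfolding y E_def by (rule e2.eval_monom1) simp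

  have I: "I = genideal P {x \<otimes>\<^bsub>P\<^esub> x, y \<otimes>\<^bsub>P\<^esub> y}"
    by (simp add: I_def ideal_X2_Y2_def x_def[symmetric] y_def[symmetric] P2 numeral_2_eq_2)
  interpret I: ideal I P unfolding I by (rule P.P.genideal_ideal) simp
  have xx: "x \<otimes>\<^bsub>P\<^esub> x \<in> I" and yy: "y \<otimes>\<^bsub>P\<^esub> y \<in> I"
    using P.P.genideal_self[of "{x \<otimes>\<^bsub>P\<^esub> x, y \<otimes>\<^bsub>P\<^esub> y}"] unfolding I by auto

  have B_split: "\<exists>a\<in>carrier K. \<exists>q\<in>carrier B. ?c p = C a \<oplus>\<^bsub>P\<^esub> x \<otimes>\<^bsub>P\<^esub> ?c q"
    if p: "p \<in> carrier B" for p
  proof -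
    obtain a q where "a \<in> carrier K" "q \<in> carrier B"
      "p = up_ring.monom B a 0 \<oplus>\<^bsub>B\<^esub> up_ring.monom B \<one>\<^bsub>K\<^esub> 1 \<otimes>\<^bsub>B\<^esub> q"
      using B.constant_plus_X_multiple[OF p] by blast
    then show ?thesis unfolding C x
      by (intro bexI[of _ a] bexI[of _ q]) simp_all
  qed
  have B_split2: "\<exists>a\<in>carrier K. \<exists>b\<in>carrier K. \<exists>r\<in>carrier P.
      ?c p = C a \<oplus>\<^bsub>P\<^esub> x \<otimes>\<^bsub>P\<^esub> (C b \<oplus>\<^bsub>P\<^esub> x \<otimes>\<^bsub>P\<^esub> r)" if p: "p \<in> carrier B" for p
  proof -
    obtain a q where 1: "a \<in> carrier K" "q \<in> carrier B" "?c p = C a \<oplus>\<^bsub>P\<^esub> x \<otimes>\<^bsub>P\<^esub> ?c q"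
      using B_split[OF p] by blast
    obtain b r where 2: "b \<in> carrier K" "r \<in> carrier B" "?c q = C b \<oplus>\<^bsub>P\<^esub> x \<otimes>\<^bsub>P\<^esub> ?c r"
      using B_split[OF 1(2)] by blast
    show ?thesis
      using 1 2 by (intro bexI[of _ a] bexI[of _ b] bexI[of _ "?c r"]) simp_all
  qed
  have P_split: "\<exists>p0\<in>carrier B. \<exists>q\<in>carrier P. p = ?c p0 \<oplus>\<^bsub>P\<^esub> y \<otimes>\<^bsub>P\<^esub> q"
    if p: "p \<in> carrier P" for p
    using P.constant_plus_X_multiple[OF p] unfolding y .
  \<comment> \<open>Two divisions by \<open>y\<close>, then two divisions by \<open>x\<close> in each of the first two coefficients.\<close>
  have reduce: "\<exists>a\<in>carrier K. \<exists>b\<in>carrier K. \<exists>c\<in>carrier K. \<exists>d\<in>carrier K. \<exists>m\<in>I.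
      p = (C a \<oplus>\<^bsub>P\<^esub> C b \<otimes>\<^bsub>P\<^esub> x \<oplus>\<^bsub>P\<^esub> C c \<otimes>\<^bsub>P\<^esub> y \<oplus>\<^bsub>P\<^esub> C d \<otimes>\<^bsub>P\<^esub> (x \<otimes>\<^bsub>P\<^esub> y)) \<oplus>\<^bsub>P\<^esub> m"
    if p: "p \<in> carrier P" for p
  proof -
    obtain p0 q where 1: "p0 \<in> carrier B" "q \<in> carrier P" "p = ?c p0 \<oplus>\<^bsub>P\<^esub> y \<otimes>\<^bsub>P\<^esub> q"
      using P_split[OF p] by blast
    obtain p1 w where 2: "p1 \<in> carrier B" "w \<in> carrier P" "q = ?c p1 \<oplus>\<^bsub>P\<^esub> y \<otimes>\<^bsub>P\<^esub> w"
      using P_split[OF 1(2)] by blast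
    obtain a b u where 3: "a \<in> carrier K" "b \<in> carrier K" "u \<in> carrier P"
      "?c p0 = C a \<oplus>\<^bsub>P\<^esub> x \<otimes>\<^bsub>P\<^esub> (C b \<oplus>\<^bsub>P\<^esub> x \<otimes>\<^bsub>P\<^esub> u)"
      using B_split2[OF 1(1)] by blast
    obtain c d v where 4: "c \<in> carrier K" "d \<in> carrier K" "v \<in> carrier P"
      "?c p1 = C c \<oplus>\<^bsub>P\<^esub> x \<otimes>\<^bsub>P\<^esub> (C d \<oplus>\<^bsub>P\<^esub> x \<otimes>\<^bsub>P\<^esub> v)"
      using B_split2[OF 2(1)] by blast
    let ?m = "(u \<oplus>\<^bsub>P\<^esub> y \<otimes>\<^bsub>P\<^esub> v) \<otimes>\<^bsub>P\<^esub> (x \<otimes>\<^bsub>P\<^esub> x) \<oplus>\<^bsub>P\<^esub> w \<otimes>\<^bsub>P\<^esub> (y \<otimes>\<^bsub>P\<^esub> y)"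
    have "?m \<in> I"
      using 2 3 4 by (intro I.a_closed I.I_l_closed[OF xx] I.I_l_closed[OF yy]) auto
    moreover have "(a' \<oplus>\<^bsub>P\<^esub> x \<otimes>\<^bsub>P\<^esub> (b' \<oplus>\<^bsub>P\<^esub> x \<otimes>\<^bsub>P\<^esub> u)) \<oplus>\<^bsub>P\<^esub> y \<otimes>\<^bsub>P\<^esub> ((c' \<oplus>\<^bsub>P\<^esub> x \<otimes>\<^bsub>P\<^esub> (d' \<oplus>\<^bsub>P\<^esub> x \<otimes>\<^bsub>P\<^esub> v)) \<oplus>\<^bsub>P\<^esub> y \<otimes>\<^bsub>P\<^esub> w)
        = (a' \<oplus>\<^bsub>P\<^esub> b' \<otimes>\<^bsub>P\<^esub> x \<oplus>\<^bsub>P\<^esub> c' \<otimes>\<^bsub>P\<^esub> y \<oplus>\<^bsub>P\<^esub> d' \<otimes>\<^bsub>P\<^esub> (x \<otimes>\<^bsub>P\<^esub> y)) \<oplus>\<^bsub>P\<^esub> ?m"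
      if "a' \<in> carrier P" "b' \<in> carrier P" "c' \<in> carrier P" "d' \<in> carrier P" for a' b' c' d'
      using that 2(2) 3(3) 4(3) x_closed y_closed by algebra
    then have "p = (C a \<oplus>\<^bsub>P\<^esub> C b \<otimes>\<^bsub>P\<^esub> x \<oplus>\<^bsub>P\<^esub> C c \<otimes>\<^bsub>P\<^esub> y \<oplus>\<^bsub>P\<^esub> C d \<otimes>\<^bsub>P\<^esub> (x \<otimes>\<^bsub>P\<^esub> y)) \<oplus>\<^bsub>P\<^esub> ?m"
      unfolding 1(3) 2(3) 3(4) 4(4) using 3(1,2) 4(1,2) by (meson C_closed)
    ultimately show ?thesis using 3 4 by blast
  qed
  have E_elt: "E (C a \<oplus>\<^bsub>P\<^esub> C b \<otimes>\<^bsub>P\<^esub> x \<oplus>\<^bsub>P\<^esub> C c \<otimes>\<^bsub>P\<^esub> y \<oplus>\<^bsub>P\<^esub> C d \<otimes>\<^bsub>P\<^esub> (x \<otimes>\<^bsub>P\<^esub> y)) = elt a b c d"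
    if "a \<in> carrier K" "b \<in> carrier K" "c \<in> carrier K" "d \<in> carrier K" for a b c d
    using that by (simp add: elt_def)

  have E_sq: "E (x \<otimes>\<^bsub>P\<^esub> x) = \<zero>" "E (y \<otimes>\<^bsub>P\<^esub> y) = \<zero>"
    by (simp_all add: X_sq Y_sq)
  have I_ker: "I \<subseteq> a_kernel P A E"
    unfolding I
  proof (rule P.P.genideal_minimal[OF ring_hom_ring.kernel_is_ideal[OF E_ring_hom]])
    show "{x \<otimes>\<^bsub>P\<^esub> x, y \<otimes>\<^bsub>P\<^esub> y} \<subseteq> a_kernel P A E"
      unfolding a_kernel_def' using E_sq P.P.m_closed[OF x_closed x_closed]
        P.P.m_closed[OF y_closed y_closed] by blast
  qed
  have ker: "a_kernel P A E = I"
  proof (intro equalityI subsetI)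
    show "p \<in> a_kernel P A E" if "p \<in> I" for p using that I_ker by blast
  next
    fix p assume "p \<in> a_kernel P A E"
    then have p: "p \<in> carrier P" "E p = \<zero>" unfolding a_kernel_def' by blast+
    obtain a b c d m where k: "a \<in> carrier K" "b \<in> carrier K" "c \<in> carrier K" "d \<in> carrier K"
      and m: "m \<in> I"
      and e: "p = (C a \<oplus>\<^bsub>P\<^esub> C b \<otimes>\<^bsub>P\<^esub> x \<oplus>\<^bsub>P\<^esub> C c \<otimes>\<^bsub>P\<^esub> y \<oplus>\<^bsub>P\<^esub> C d \<otimes>\<^bsub>P\<^esub> (x \<otimes>\<^bsub>P\<^esub> y)) \<oplus>\<^bsub>P\<^esub> m"
      using reduce[OF p(1)] by blast
    have m0: "m \<in> carrier P" "E m = \<zero>" using m I_ker unfolding a_kernel_def' by blast+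
    have "E p = elt a b c d"
      unfolding e using k m0 by (simp add: elt_def)
    then have "elt a b c d = \<zero>" using p(2) by simp
    from elt_eq_zero[OF k this] have "a = \<zero>\<^bsub>K\<^esub>" "b = \<zero>\<^bsub>K\<^esub>" "c = \<zero>\<^bsub>K\<^esub>" "d = \<zero>\<^bsub>K\<^esub>" .
    moreover have "C \<zero>\<^bsub>K\<^esub> = \<zero>\<^bsub>P\<^esub>" by (simp add: C)
    ultimately show "p \<in> I" using m m0 unfolding e by simp
  qed
  have surj: "E ` carrier P = carrier A"
  proof (intro equalityI subsetI)
    fix a assume a: "a \<in> carrier A"
    obtain \<beta> \<gamma> \<delta> where c: "\<beta> \<in> carrier K" "\<gamma> \<in> carrier K" "\<delta> \<in> carrier K"
      and e: "a = elt (\<epsilon> a) \<beta> \<gamma> \<delta>" using coordinates[OF a] .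
    have "a = E (C (\<epsilon> a) \<oplus>\<^bsub>P\<^esub> C \<beta> \<otimes>\<^bsub>P\<^esub> x \<oplus>\<^bsub>P\<^esub> C \<gamma> \<otimes>\<^bsub>P\<^esub> y \<oplus>\<^bsub>P\<^esub> C \<delta> \<otimes>\<^bsub>P\<^esub> (x \<otimes>\<^bsub>P\<^esub> y))"
      using c a by (subst E_elt) (simp_all flip: e)
    moreover have "C (\<epsilon> a) \<oplus>\<^bsub>P\<^esub> C \<beta> \<otimes>\<^bsub>P\<^esub> x \<oplus>\<^bsub>P\<^esub> C \<gamma> \<otimes>\<^bsub>P\<^esub> y \<oplus>\<^bsub>P\<^esub> C \<delta> \<otimes>\<^bsub>P\<^esub> (x \<otimes>\<^bsub>P\<^esub> y) \<in> carrier P"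
      by (intro P.P.a_closed P.P.m_closed C_closed x_closed y_closed c eps.hom_closed a)
    ultimately show "a \<in> E ` carrier P" by (rule image_eqI)
  next
    fix a assume "a \<in> E ` carrier P"
    then show "a \<in> carrier A" using E.hom_closed by blast
  qed
  let ?F = "\<lambda>U. the_elem (E ` U)"
  have F: "?F \<in> ring_iso (P Quot I) A" using ring_hom_ring.FactRing_iso_set[OF E_ring_hom surj] by (simp add: ker)
  have "ring (P Quot I)" by (rule I.quotient_is_ring)
  then have iso: "inv_into (carrier (P Quot I)) ?F \<in> ring_iso A (P Quot I)"
    using F by (rule ring_iso_set_sym)
  have "inv_into (carrier (P Quot I)) ?F (E p) = I +>\<^bsub>P\<^esub> p" if p: "p \<in> carrier P" for p
  proof -
    have "E ` (I +>\<^bsub>P\<^esub> p) = {E p}"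
    proof -
      have "E q = E p" if q: "q \<in> I +>\<^bsub>P\<^esub> p" for q
      proof -
        obtain m where m: "m \<in> a_kernel P A E" "q = m \<oplus>\<^bsub>P\<^esub> p"
          using q unfolding ker a_r_coset_def' by blast
        then have "m \<in> carrier P" "E m = \<zero>" unfolding a_kernel_def' by blast+
        then show ?thesis using p m(2) by simp
      qed
      then show ?thesis using I.a_rcos_self[OF p] by blast
    qed
    then have Fp: "?F (I +>\<^bsub>P\<^esub> p) = E p" by simp
    have "inj_on ?F (carrier (P Quot I))"
      using F by (simp add: ring_iso_def bij_betw_def)
    moreover have "I +>\<^bsub>P\<^esub> p \<in> carrier (P Quot I)"
      using p by (auto simp: FactRing_def A_RCOSETS_def')
    ultimately have "inv_into (carrier (P Quot I)) ?F (?F (I +>\<^bsub>P\<^esub> p)) = I +>\<^bsub>P\<^esub> p"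
      by (rule inv_into_f_f)
    then show ?thesis by (simp only: Fp)
  qed
  note inv_E = this
  let ?\<phi> = "inv_into (carrier (P Quot I)) ?F"
  have "?\<phi> (\<iota> c) = I +>\<^bsub>P\<^esub> C c" if "c \<in> carrier K" for c
    using inv_E[OF C_closed[OF that]] that by simp
  moreover have "?\<phi> \<xi> = I +>\<^bsub>P\<^esub> x" "?\<phi> \<eta> = I +>\<^bsub>P\<^esub> y"
    using inv_E[OF x_closed] inv_E[OF y_closed] by simp_all
  ultimately show ?thesis
    unfolding I_def[symmetric] C_def[symmetric] x_def[symmetric] y_def[symmetric] P2
    by (intro bexI[OF _ iso]) blast
qed

end

section \<open>Group algebras of finite abelian groups\<close>

lemma (in abelian_monoid) finsum_swap:
  assumes "finite S" "finite T" and f: "\<And>i j. \<lbrakk>i \<in> S; j \<in> T\<rbrakk> \<Longrightarrow> f i j \<in> carrier G"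
  shows "(\<Oplus>i\<in>S. \<Oplus>j\<in>T. f i j) = (\<Oplus>j\<in>T. \<Oplus>i\<in>S. f i j)"
  using assms(1) f
proof (induction S)
  case empty
  then show ?case by simp
next
  case (insert s S)
  have "(\<Oplus>i\<in>insert s S. \<Oplus>j\<in>T. f i j) = (\<Oplus>j\<in>T. f s j) \<oplus> (\<Oplus>i\<in>S. \<Oplus>j\<in>T. f i j)"
    using insert by (intro finsum_insert) (auto intro!: finsum_closed)
  also have "\<dots> = (\<Oplus>j\<in>T. f s j) \<oplus> (\<Oplus>j\<in>T. \<Oplus>i\<in>S. f i j)"
    using insert by simp
  also have "\<dots> = (\<Oplus>j\<in>T. f s j \<oplus> (\<Oplus>i\<in>S. f i j))"
    using insert by (intro finsum_addf[symmetric]) (auto intro!: finsum_closed)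
  also have "\<dots> = (\<Oplus>j\<in>T. \<Oplus>i\<in>insert s S. f i j)"
    using insert by (intro finsum_cong') (auto intro!: finsum_closed finsum_insert[symmetric])
  finally show ?case .
qed

text \<open>For a commutative group the group algebra is commutative, so it can serve as the scalar ring of modules.\<close>

locale finite_group_algebra = K?: cring K + G: comm_group G
  for K (structure) and G (structure) +
  assumes finite_G: "finite (carrier G)"
begin

abbreviation KG :: "('a, 'c \<Rightarrow> 'a) module" where "KG \<equiv> group_algebra K G"
abbreviation g_elt :: "'c \<Rightarrow> 'c \<Rightarrow> 'a" where "g_elt \<equiv> group_element K G"

lemma KG_simps:
  "carrier KG = carrier G \<rightarrow>\<^sub>E carrier K"
  "a \<otimes>\<^bsub>KG\<^esub> b = (\<lambda>g\<in>carrier G. \<Oplus>\<^bsub>K\<^esub>h\<in>carrier G. a h \<otimes>\<^bsub>K\<^esub> b (inv\<^bsub>G\<^esub> h \<otimes>\<^bsub>G\<^esub> g))"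
  "\<one>\<^bsub>KG\<^esub> = g_elt \<one>\<^bsub>G\<^esub>"
  "\<zero>\<^bsub>KG\<^esub> = (\<lambda>g\<in>carrier G. \<zero>\<^bsub>K\<^esub>)"
  "a \<oplus>\<^bsub>KG\<^esub> b = (\<lambda>g\<in>carrier G. a g \<oplus>\<^bsub>K\<^esub> b g)"
  "c \<odot>\<^bsub>KG\<^esub> a = (\<lambda>g\<in>carrier G. c \<otimes>\<^bsub>K\<^esub> a g)"
  by (simp_all add: group_algebra_def group_element_def)

lemma coeff_closed [simp]:
  "\<lbrakk>a \<in> carrier KG; g \<in> carrier G\<rbrakk> \<Longrightarrow> a g \<in> carrier K"
  by (auto simp: KG_simps)

lemma KG_eqI:
  assumes "a \<in> carrier KG" "b \<in> carrier KG" "\<And>g. g \<in> carrier G \<Longrightarrow> a g = b g"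
  shows "a = b"
  using assms unfolding KG_simps by (intro PiE_ext) auto

lemma sum_closed: "(\<And>g. g \<in> carrier G \<Longrightarrow> f g \<in> carrier K) \<Longrightarrow> (\<Oplus>\<^bsub>K\<^esub>g\<in>carrier G. f g) \<in> carrier K"
  by (rule K.finsum_closed) auto

lemma sum_reindex:
  assumes "bij_betw s (carrier G) (carrier G)" "\<And>g. g \<in> carrier G \<Longrightarrow> f g \<in> carrier K"
  shows "(\<Oplus>\<^bsub>K\<^esub>g\<in>carrier G. f g) = (\<Oplus>\<^bsub>K\<^esub>g\<in>carrier G. f (s g))"
  using K.finsum_reindex[of f s "carrier G"] assms by (auto simp: bij_betw_def)

lemma bij_mult: "l \<in> carrier G \<Longrightarrow> bij_betw (\<lambda>m. l \<otimes>\<^bsub>G\<^esub> m) (carrier G) (carrier G)"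
  by (simp add: bij_betw_def G.inj_on_cmult G.surj_const_mult)

lemma bij_div:
  assumes [simp]: "g \<in> carrier G"
  shows "bij_betw (\<lambda>m. g \<otimes>\<^bsub>G\<^esub> inv\<^bsub>G\<^esub> m) (carrier G) (carrier G)"
  by (rule bij_betw_byWitness[where f' = "\<lambda>m. g \<otimes>\<^bsub>G\<^esub> inv\<^bsub>G\<^esub> m"])
    (auto simp: G.inv_mult_group G.m_assoc[symmetric] G.m_comm[of g])

lemma mult_KG_closed:
  assumes "a \<in> carrier KG" "b \<in> carrier KG"
  shows "a \<otimes>\<^bsub>KG\<^esub> b \<in> carrier KG"
  using assms unfolding KG_simps(1,2) by (auto intro!: sum_closed)

lemma mult_apply:
  "g \<in> carrier G \<Longrightarrow> (a \<otimes>\<^bsub>KG\<^esub> b) g = (\<Oplus>\<^bsub>K\<^esub>h\<in>carrier G. a h \<otimes>\<^bsub>K\<^esub> b (inv\<^bsub>G\<^esub> h \<otimes>\<^bsub>G\<^esub> g))"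
  by (simp add: KG_simps)

lemma g_elt_closed: "g_elt x \<in> carrier KG"
  by (auto simp: KG_simps group_element_def)

lemma sum_single:
  assumes "c \<in> carrier K" "x \<in> carrier G" "\<And>g. g \<in> carrier G \<Longrightarrow> f g \<in> carrier K"
  shows "(\<Oplus>\<^bsub>K\<^esub>h\<in>carrier G. (if h = x then c else \<zero>\<^bsub>K\<^esub>) \<otimes>\<^bsub>K\<^esub> f h) = c \<otimes>\<^bsub>K\<^esub> f x"
proof -
  have "(\<Oplus>\<^bsub>K\<^esub>h\<in>carrier G. (if h = x then c else \<zero>\<^bsub>K\<^esub>) \<otimes>\<^bsub>K\<^esub> f h)
      = (\<Oplus>\<^bsub>K\<^esub>h\<in>carrier G. if x = h then c \<otimes>\<^bsub>K\<^esub> f h else \<zero>\<^bsub>K\<^esub>)"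
    using assms by (intro K.finsum_cong') auto
  also have "\<dots> = c \<otimes>\<^bsub>K\<^esub> f x"
    using assms finite_G by (intro K.finsum_singleton) auto
  finally show ?thesis .
qed

lemma smult_g_elt_mult:
  assumes "x \<in> carrier G" "a \<in> carrier KG" "c \<in> carrier K"
  shows "(c \<odot>\<^bsub>KG\<^esub> g_elt x) \<otimes>\<^bsub>KG\<^esub> a = (\<lambda>g\<in>carrier G. c \<otimes>\<^bsub>K\<^esub> a (inv\<^bsub>G\<^esub> x \<otimes>\<^bsub>G\<^esub> g))"
proof (rule ext)
  fix g
  show "((c \<odot>\<^bsub>KG\<^esub> g_elt x) \<otimes>\<^bsub>KG\<^esub> a) g = (\<lambda>g\<in>carrier G. c \<otimes>\<^bsub>K\<^esub> a (inv\<^bsub>G\<^esub> x \<otimes>\<^bsub>G\<^esub> g)) g"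
  proof (cases "g \<in> carrier G")
    case True
    have "((c \<odot>\<^bsub>KG\<^esub> g_elt x) \<otimes>\<^bsub>KG\<^esub> a) g
        = (\<Oplus>\<^bsub>K\<^esub>h\<in>carrier G. (if h = x then c else \<zero>\<^bsub>K\<^esub>) \<otimes>\<^bsub>K\<^esub> a (inv\<^bsub>G\<^esub> h \<otimes>\<^bsub>G\<^esub> g))"
      unfolding mult_apply[OF True]
      using assms True by (intro K.finsum_cong') (auto simp: KG_simps(6) group_element_def)
    also have "\<dots> = c \<otimes>\<^bsub>K\<^esub> a (inv\<^bsub>G\<^esub> x \<otimes>\<^bsub>G\<^esub> g)"
      using assms True by (intro sum_single) auto
    finally show ?thesis using True by simp
  qed (simp add: KG_simps)
qed

lemma mult_KG_comm:
  assumes a: "a \<in> carrier KG" and b: "b \<in> carrier KG"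
  shows "a \<otimes>\<^bsub>KG\<^esub> b = b \<otimes>\<^bsub>KG\<^esub> a"
proof (rule KG_eqI[OF mult_KG_closed[OF a b] mult_KG_closed[OF b a]])
  fix g assume g: "g \<in> carrier G"
  have "(a \<otimes>\<^bsub>KG\<^esub> b) g
      = (\<Oplus>\<^bsub>K\<^esub>h\<in>carrier G. a (g \<otimes>\<^bsub>G\<^esub> inv\<^bsub>G\<^esub> h) \<otimes>\<^bsub>K\<^esub> b (inv\<^bsub>G\<^esub> (g \<otimes>\<^bsub>G\<^esub> inv\<^bsub>G\<^esub> h) \<otimes>\<^bsub>G\<^esub> g))"
    unfolding mult_apply[OF g] using a b g by (intro sum_reindex[OF bij_div[OF g]]) auto
  also have "\<dots> = (\<Oplus>\<^bsub>K\<^esub>h\<in>carrier G. b h \<otimes>\<^bsub>K\<^esub> a (inv\<^bsub>G\<^esub> h \<otimes>\<^bsub>G\<^esub> g))"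
  proof (rule K.finsum_cong')
    fix h assume h: "h \<in> carrier G"
    have "inv\<^bsub>G\<^esub> (g \<otimes>\<^bsub>G\<^esub> inv\<^bsub>G\<^esub> h) \<otimes>\<^bsub>G\<^esub> g = h"
      using g h by (simp add: G.inv_mult_group G.m_assoc)
    then show "a (g \<otimes>\<^bsub>G\<^esub> inv\<^bsub>G\<^esub> h) \<otimes>\<^bsub>K\<^esub> b (inv\<^bsub>G\<^esub> (g \<otimes>\<^bsub>G\<^esub> inv\<^bsub>G\<^esub> h) \<otimes>\<^bsub>G\<^esub> g)
        = b h \<otimes>\<^bsub>K\<^esub> a (inv\<^bsub>G\<^esub> h \<otimes>\<^bsub>G\<^esub> g)"
      using a b g h by (simp add: G.m_comm[of g] K.m_comm)
  qed (use a b g in auto)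
  finally show "(a \<otimes>\<^bsub>KG\<^esub> b) g = (b \<otimes>\<^bsub>KG\<^esub> a) g" by (simp add: mult_apply[OF g])
qed

text \<open>Both sides expand to a double sum; they agree after exchanging the sums and substituting \<open>h = l m\<close>.\<close>

lemma mult_KG_assoc:
  assumes a: "a \<in> carrier KG" and b: "b \<in> carrier KG" and c: "c \<in> carrier KG"
  shows "(a \<otimes>\<^bsub>KG\<^esub> b) \<otimes>\<^bsub>KG\<^esub> c = a \<otimes>\<^bsub>KG\<^esub> (b \<otimes>\<^bsub>KG\<^esub> c)"
proof (rule KG_eqI)
  fix g assume g: "g \<in> carrier G"
  have "((a \<otimes>\<^bsub>KG\<^esub> b) \<otimes>\<^bsub>KG\<^esub> c) g = (\<Oplus>\<^bsub>K\<^esub>h\<in>carrier G. \<Oplus>\<^bsub>K\<^esub>l\<in>carrier G.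
      a l \<otimes>\<^bsub>K\<^esub> b (inv\<^bsub>G\<^esub> l \<otimes>\<^bsub>G\<^esub> h) \<otimes>\<^bsub>K\<^esub> c (inv\<^bsub>G\<^esub> h \<otimes>\<^bsub>G\<^esub> g))"
    unfolding mult_apply[OF g]
  proof (rule K.finsum_cong')
    fix h assume h: "h \<in> carrier G"
    show "(a \<otimes>\<^bsub>KG\<^esub> b) h \<otimes>\<^bsub>K\<^esub> c (inv\<^bsub>G\<^esub> h \<otimes>\<^bsub>G\<^esub> g)
      = (\<Oplus>\<^bsub>K\<^esub>l\<in>carrier G. a l \<otimes>\<^bsub>K\<^esub> b (inv\<^bsub>G\<^esub> l \<otimes>\<^bsub>G\<^esub> h) \<otimes>\<^bsub>K\<^esub> c (inv\<^bsub>G\<^esub> h \<otimes>\<^bsub>G\<^esub> g))"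
      unfolding mult_apply[OF h]
      using a b c g h finite_G by (intro K.finsum_ldistr) auto
  qed (use a b c g in \<open>auto intro!: sum_closed\<close>)
  also have "\<dots> = (\<Oplus>\<^bsub>K\<^esub>l\<in>carrier G. \<Oplus>\<^bsub>K\<^esub>h\<in>carrier G.
      a l \<otimes>\<^bsub>K\<^esub> b (inv\<^bsub>G\<^esub> l \<otimes>\<^bsub>G\<^esub> h) \<otimes>\<^bsub>K\<^esub> c (inv\<^bsub>G\<^esub> h \<otimes>\<^bsub>G\<^esub> g))"
    using a b c g finite_G by (intro K.finsum_swap) auto
  also have "\<dots> = (\<Oplus>\<^bsub>K\<^esub>l\<in>carrier G. a l \<otimes>\<^bsub>K\<^esub> (b \<otimes>\<^bsub>KG\<^esub> c) (inv\<^bsub>G\<^esub> l \<otimes>\<^bsub>G\<^esub> g))"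
  proof (rule K.finsum_cong')
    fix l assume l: "l \<in> carrier G"
    have "(\<Oplus>\<^bsub>K\<^esub>h\<in>carrier G. a l \<otimes>\<^bsub>K\<^esub> b (inv\<^bsub>G\<^esub> l \<otimes>\<^bsub>G\<^esub> h) \<otimes>\<^bsub>K\<^esub> c (inv\<^bsub>G\<^esub> h \<otimes>\<^bsub>G\<^esub> g))
        = (\<Oplus>\<^bsub>K\<^esub>m\<in>carrier G. a l \<otimes>\<^bsub>K\<^esub> b (inv\<^bsub>G\<^esub> l \<otimes>\<^bsub>G\<^esub> (l \<otimes>\<^bsub>G\<^esub> m))
            \<otimes>\<^bsub>K\<^esub> c (inv\<^bsub>G\<^esub> (l \<otimes>\<^bsub>G\<^esub> m) \<otimes>\<^bsub>G\<^esub> g))"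
      using a b c g l by (intro sum_reindex[OF bij_mult[OF l]]) auto
    also have "\<dots> = (\<Oplus>\<^bsub>K\<^esub>m\<in>carrier G. a l \<otimes>\<^bsub>K\<^esub> (b m \<otimes>\<^bsub>K\<^esub> c (inv\<^bsub>G\<^esub> m \<otimes>\<^bsub>G\<^esub> (inv\<^bsub>G\<^esub> l \<otimes>\<^bsub>G\<^esub> g))))"
      using a b c g l
      by (intro K.finsum_cong')
        (auto simp: G.inv_mult_group G.m_assoc[symmetric] K.m_assoc)
    also have "\<dots> = a l \<otimes>\<^bsub>K\<^esub> (b \<otimes>\<^bsub>KG\<^esub> c) (inv\<^bsub>G\<^esub> l \<otimes>\<^bsub>G\<^esub> g)"
      using a b c g l finite_G by (simp add: mult_apply K.finsum_rdistr Pi_def)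
    finally show "(\<Oplus>\<^bsub>K\<^esub>h\<in>carrier G. a l \<otimes>\<^bsub>K\<^esub> b (inv\<^bsub>G\<^esub> l \<otimes>\<^bsub>G\<^esub> h) \<otimes>\<^bsub>K\<^esub> c (inv\<^bsub>G\<^esub> h \<otimes>\<^bsub>G\<^esub> g))
        = a l \<otimes>\<^bsub>K\<^esub> (b \<otimes>\<^bsub>KG\<^esub> c) (inv\<^bsub>G\<^esub> l \<otimes>\<^bsub>G\<^esub> g)" .
  qed (use a b c g mult_KG_closed in auto)
  finally show "((a \<otimes>\<^bsub>KG\<^esub> b) \<otimes>\<^bsub>KG\<^esub> c) g = (a \<otimes>\<^bsub>KG\<^esub> (b \<otimes>\<^bsub>KG\<^esub> c)) g"
    by (simp add: mult_apply[OF g])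
qed (use a b c mult_KG_closed in auto)

lemma add_KG_closed: "\<lbrakk>a \<in> carrier KG; b \<in> carrier KG\<rbrakk> \<Longrightarrow> a \<oplus>\<^bsub>KG\<^esub> b \<in> carrier KG"
  by (auto simp: KG_simps)

lemma one_mult_KG:
  assumes a: "a \<in> carrier KG"
  shows "\<one>\<^bsub>KG\<^esub> \<otimes>\<^bsub>KG\<^esub> a = a"
proof -
  have "g_elt \<one>\<^bsub>G\<^esub> = \<one>\<^bsub>K\<^esub> \<odot>\<^bsub>KG\<^esub> g_elt \<one>\<^bsub>G\<^esub>"
    by (auto simp: KG_simps group_element_def)
  then have "\<one>\<^bsub>KG\<^esub> \<otimes>\<^bsub>KG\<^esub> a = (\<lambda>g\<in>carrier G. \<one>\<^bsub>K\<^esub> \<otimes>\<^bsub>K\<^esub> a (inv\<^bsub>G\<^esub> \<one>\<^bsub>G\<^esub> \<otimes>\<^bsub>G\<^esub> g))"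
    using smult_g_elt_mult[OF G.one_closed a K.one_closed] by (simp only: KG_simps(3))
  also have "\<dots> = a"
    using a by (intro KG_eqI) (auto simp: KG_simps(1))
  finally show ?thesis .
qed

lemma distrib_KG:
  assumes a: "a \<in> carrier KG" and b: "b \<in> carrier KG" and c: "c \<in> carrier KG"
  shows "(a \<oplus>\<^bsub>KG\<^esub> b) \<otimes>\<^bsub>KG\<^esub> c = a \<otimes>\<^bsub>KG\<^esub> c \<oplus>\<^bsub>KG\<^esub> b \<otimes>\<^bsub>KG\<^esub> c"
proof (rule KG_eqI)
  fix g assume g: "g \<in> carrier G"
  have "((a \<oplus>\<^bsub>KG\<^esub> b) \<otimes>\<^bsub>KG\<^esub> c) g = (\<Oplus>\<^bsub>K\<^esub>h\<in>carrier G.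
      a h \<otimes>\<^bsub>K\<^esub> c (inv\<^bsub>G\<^esub> h \<otimes>\<^bsub>G\<^esub> g) \<oplus>\<^bsub>K\<^esub> b h \<otimes>\<^bsub>K\<^esub> c (inv\<^bsub>G\<^esub> h \<otimes>\<^bsub>G\<^esub> g))"
    unfolding mult_apply[OF g] using a b c g
    by (intro K.finsum_cong') (auto simp: KG_simps(5) K.l_distr)
  also have "\<dots> = (a \<otimes>\<^bsub>KG\<^esub> c) g \<oplus>\<^bsub>K\<^esub> (b \<otimes>\<^bsub>KG\<^esub> c) g"
    unfolding mult_apply[OF g] using a b c g by (intro K.finsum_addf) auto
  finally show "((a \<oplus>\<^bsub>KG\<^esub> b) \<otimes>\<^bsub>KG\<^esub> c) g = (a \<otimes>\<^bsub>KG\<^esub> c \<oplus>\<^bsub>KG\<^esub> b \<otimes>\<^bsub>KG\<^esub> c) g"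
    using g by (simp add: KG_simps(5))
qed (use a b c in \<open>auto intro!: mult_KG_closed add_KG_closed\<close>)

lemma cring_KG: "cring KG"
proof (rule cringI)
  show "abelian_group KG"
  proof (rule abelian_groupI)
    show "\<exists>b\<in>carrier KG. b \<oplus>\<^bsub>KG\<^esub> a = \<zero>\<^bsub>KG\<^esub>" if "a \<in> carrier KG" for a
      using that
      by (intro bexI[of _ "\<lambda>g\<in>carrier G. \<ominus>\<^bsub>K\<^esub> a g"]) (auto simp: KG_simps K.l_neg fun_eq_iff)
    show "\<zero>\<^bsub>KG\<^esub> \<oplus>\<^bsub>KG\<^esub> a = a" if "a \<in> carrier KG" for a
      using that by (intro KG_eqI) (auto simp: KG_simps)
  qed (auto simp: KG_simps fun_eq_iff K.a_ac PiE_mem)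
  show "comm_monoid KG"
    by (rule comm_monoidI)
      (simp_all add: mult_KG_closed mult_KG_assoc one_mult_KG KG_simps(3)[symmetric],
        simp_all add: KG_simps(3) g_elt_closed mult_KG_comm)
qed (rule distrib_KG)

definition scalar :: "'a \<Rightarrow> 'c \<Rightarrow> 'a" where
  "scalar c = c \<odot>\<^bsub>KG\<^esub> \<one>\<^bsub>KG\<^esub>"

lemma smult_closed: "\<lbrakk>c \<in> carrier K; a \<in> carrier KG\<rbrakk> \<Longrightarrow> c \<odot>\<^bsub>KG\<^esub> a \<in> carrier KG"
  by (auto simp: KG_simps)

lemma scalar_mult:
  assumes "c \<in> carrier K" "a \<in> carrier KG"
  shows "scalar c \<otimes>\<^bsub>KG\<^esub> a = c \<odot>\<^bsub>KG\<^esub> a"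
  unfolding scalar_def KG_simps(3) smult_g_elt_mult[OF G.one_closed assms(2,1)]
  by (auto simp: KG_simps)

lemma scalar_hom: "scalar \<in> ring_hom K KG"
proof (rule ring_hom_memI)
  fix c d assume cd: "c \<in> carrier K" "d \<in> carrier K"
  show "scalar c \<in> carrier KG"
    using cd by (simp add: scalar_def smult_closed KG_simps(3) g_elt_closed)
  show "scalar (c \<oplus>\<^bsub>K\<^esub> d) = scalar c \<oplus>\<^bsub>KG\<^esub> scalar d"
    using cd by (auto simp: scalar_def KG_simps group_element_def fun_eq_iff)
  have "scalar c \<otimes>\<^bsub>KG\<^esub> scalar d = c \<odot>\<^bsub>KG\<^esub> scalar d"
    using cd by (intro scalar_mult) (simp_all add: scalar_def smult_closed KG_simps(3) g_elt_closed)
  then show "scalar (c \<otimes>\<^bsub>K\<^esub> d) = scalar c \<otimes>\<^bsub>KG\<^esub> scalar d"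
    using cd by (auto simp: scalar_def KG_simps(3,6) group_element_def fun_eq_iff)
next
  show "scalar \<one>\<^bsub>K\<^esub> = \<one>\<^bsub>KG\<^esub>"
    by (auto simp: scalar_def KG_simps group_element_def fun_eq_iff)
qed

lemma g_elt_mult:
  assumes "x \<in> carrier G" "y \<in> carrier G"
  shows "g_elt x \<otimes>\<^bsub>KG\<^esub> g_elt y = g_elt (x \<otimes>\<^bsub>G\<^esub> y)"
proof -
  have e: "g_elt x = \<one>\<^bsub>K\<^esub> \<odot>\<^bsub>KG\<^esub> g_elt x"
    by (auto simp: KG_simps group_element_def)
  have "inv\<^bsub>G\<^esub> x \<otimes>\<^bsub>G\<^esub> g = y \<longleftrightarrow> g = x \<otimes>\<^bsub>G\<^esub> y" if "g \<in> carrier G" for g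
    using G.inv_solve_left'[OF assms(2,1) that] .
  then show ?thesis
    using assms
    by (subst e, subst smult_g_elt_mult[OF _ g_elt_closed]) (auto simp: group_element_def)
qed

definition augmentation :: "('c \<Rightarrow> 'a) \<Rightarrow> 'a" where
  "augmentation a = (\<Oplus>\<^bsub>K\<^esub>g\<in>carrier G. a g)"

lemma augmentation_smult:
  assumes "c \<in> carrier K" "x \<in> carrier G"
  shows "augmentation (c \<odot>\<^bsub>KG\<^esub> g_elt x) = c"
proof -
  have "augmentation (c \<odot>\<^bsub>KG\<^esub> g_elt x) = (\<Oplus>\<^bsub>K\<^esub>h\<in>carrier G. (if h = x then c else \<zero>\<^bsub>K\<^esub>) \<otimes>\<^bsub>K\<^esub> \<one>\<^bsub>K\<^esub>)"
    unfolding augmentation_def using assms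
    by (intro K.finsum_cong') (auto simp: KG_simps group_element_def)
  also have "\<dots> = c \<otimes>\<^bsub>K\<^esub> \<one>\<^bsub>K\<^esub>" using assms by (intro sum_single) auto
  finally show ?thesis using assms by simp
qed

text \<open>For products, exchange the two sums and translate the summation variable of the second factor.\<close>

lemma augmentation_hom: "augmentation \<in> ring_hom KG K"
proof (rule ring_hom_memI)
  fix a b assume a: "a \<in> carrier KG" and b: "b \<in> carrier KG"
  show "augmentation a \<in> carrier K" using a by (simp add: augmentation_def sum_closed)
  have "augmentation (a \<oplus>\<^bsub>KG\<^esub> b) = (\<Oplus>\<^bsub>K\<^esub>g\<in>carrier G. a g \<oplus>\<^bsub>K\<^esub> b g)"
    unfolding augmentation_def using a b by (intro K.finsum_cong') (auto simp: KG_simps(5))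
  also have "\<dots> = augmentation a \<oplus>\<^bsub>K\<^esub> augmentation b"
    unfolding augmentation_def using a b by (intro K.finsum_addf) auto
  finally show "augmentation (a \<oplus>\<^bsub>KG\<^esub> b) = augmentation a \<oplus>\<^bsub>K\<^esub> augmentation b" .
  have "augmentation (a \<otimes>\<^bsub>KG\<^esub> b)
      = (\<Oplus>\<^bsub>K\<^esub>g\<in>carrier G. \<Oplus>\<^bsub>K\<^esub>h\<in>carrier G. a h \<otimes>\<^bsub>K\<^esub> b (inv\<^bsub>G\<^esub> h \<otimes>\<^bsub>G\<^esub> g))"
    unfolding augmentation_def using a b
    by (intro K.finsum_cong') (auto simp: mult_apply intro!: sum_closed)
  also have "\<dots> = (\<Oplus>\<^bsub>K\<^esub>h\<in>carrier G. \<Oplus>\<^bsub>K\<^esub>g\<in>carrier G. a h \<otimes>\<^bsub>K\<^esub> b (inv\<^bsub>G\<^esub> h \<otimes>\<^bsub>G\<^esub> g))"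
    using a b finite_G by (intro K.finsum_swap) auto
  also have "\<dots> = (\<Oplus>\<^bsub>K\<^esub>h\<in>carrier G. a h \<otimes>\<^bsub>K\<^esub> augmentation b)"
  proof (rule K.finsum_cong')
    fix h assume h: "h \<in> carrier G"
    have "augmentation b = (\<Oplus>\<^bsub>K\<^esub>g\<in>carrier G. b (inv\<^bsub>G\<^esub> h \<otimes>\<^bsub>G\<^esub> g))"
      unfolding augmentation_def using b h by (intro sum_reindex[OF bij_mult]) auto
    then show "(\<Oplus>\<^bsub>K\<^esub>g\<in>carrier G. a h \<otimes>\<^bsub>K\<^esub> b (inv\<^bsub>G\<^esub> h \<otimes>\<^bsub>G\<^esub> g)) = a h \<otimes>\<^bsub>K\<^esub> augmentation b"
      using a b h finite_G by (simp add: K.finsum_rdistr Pi_def)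
  qed (use a b in \<open>auto simp: augmentation_def intro!: sum_closed\<close>)
  also have "\<dots> = augmentation a \<otimes>\<^bsub>K\<^esub> augmentation b"
    unfolding augmentation_def using a b finite_G
    by (intro K.finsum_ldistr[symmetric] sum_closed) auto
  finally show "augmentation (a \<otimes>\<^bsub>KG\<^esub> b) = augmentation a \<otimes>\<^bsub>K\<^esub> augmentation b" .
next
  have "\<one>\<^bsub>KG\<^esub> = \<one>\<^bsub>K\<^esub> \<odot>\<^bsub>KG\<^esub> g_elt \<one>\<^bsub>G\<^esub>" by (auto simp: KG_simps group_element_def)
  then show "augmentation \<one>\<^bsub>KG\<^esub> = \<one>\<^bsub>K\<^esub>" by (simp add: augmentation_smult)
qed

end

section \<open>The Klein four-group in characteristic two\<close>

text \<open>Trivial squares and commutativity carry over from the direct product. Hence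
\<open>{1, x, y, x y}\<close> is a subgroup; it contains the generators, and the order \<open>4\<close> of the group forces
its four elements to be distinct.\<close>

lemma klein_four_group:
  fixes G (structure)
  assumes "group G" and iso: "G \<cong> integer_mod_group 2 \<times>\<times> integer_mod_group 2"
    and x: "x \<in> carrier G" and y: "y \<in> carrier G" and gen: "generate G {x, y} = carrier G"
  shows "comm_group G" and "\<And>g. g \<in> carrier G \<Longrightarrow> g \<otimes> g = \<one>"
    and "carrier G = {\<one>, x, y, x \<otimes> y}" and "distinct [\<one>, x, y, x \<otimes> y]"
proof -
  interpret group G by fact
  let ?V = "integer_mod_group 2 \<times>\<times> integer_mod_group 2"
  interpret V: group ?V by (intro DirProd_group) simp_all
  obtain f where f: "f \<in> iso G ?V" using iso by (auto simp: is_iso_def)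
  then have hom: "f \<in> hom G ?V" and inj: "inj_on f (carrier G)" by (auto simp: iso_def bij_betw_def)
  have f1: "f \<one> = (0, 0)" using hom_one[OF hom group_axioms V.group_axioms] by simp
  have fm: "f (a \<otimes> b) = f a \<otimes>\<^bsub>?V\<^esub> f b" if "a \<in> carrier G" "b \<in> carrier G" for a b
    using hom that by (simp add: hom_def)
  show sq: "g \<otimes> g = \<one>" if g: "g \<in> carrier G" for g
  proof (rule inj_onD[OF inj])
    show "f (g \<otimes> g) = f \<one>" using g by (simp add: fm f1 mult_DirProd')
  qed (use g in auto)
  have comm: "a \<otimes> b = b \<otimes> a" if ab: "a \<in> carrier G" "b \<in> carrier G" for a b
  proof (rule inj_onD[OF inj])
    show "f (a \<otimes> b) = f (b \<otimes> a)" using ab by (simp add: fm mult_DirProd' add.commute)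
  qed (use ab in auto)
  show "comm_group G" by (rule group_comm_groupI) (rule comm)
  then interpret G: comm_group G .
  have cancel: "a \<otimes> (a \<otimes> b) = b" if "a \<in> carrier G" "b \<in> carrier G" for a b
    using that by (simp add: sq flip: m_assoc)
  have inv: "inv a = a" if "a \<in> carrier G" for a
    using that by (intro inv_equality sq)
  have "subgroup {\<one>, x, y, x \<otimes> y} G"
    by (rule subgroupI) (use x y in \<open>auto simp: inv sq cancel G.m_ac\<close>)
  then have "carrier G \<subseteq> {\<one>, x, y, x \<otimes> y}"
    using generate_subgroup_incl[of "{x, y}" "{\<one>, x, y, x \<otimes> y}"] gen by simp
  then show carr: "carrier G = {\<one>, x, y, x \<otimes> y}" using x y by auto
  have "card (set [\<one>, x, y, x \<otimes> y]) = card (carrier G)" by (simp only: carr list.set)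
  also have "\<dots> = length [\<one>, x, y, x \<otimes> y]"
    using iso_same_card[OF iso] by (simp add: carrier_integer_mod_group)
  finally show "distinct [\<one>, x, y, x \<otimes> y]" by (rule card_distinct)
qed

lemma characteristic_2:
  fixes K (structure)
  assumes "ring K" "characteristic K = 2"
  shows "\<one> \<oplus> \<one> = \<zero>"
proof -
  interpret ring K by fact
  have "\<one> [^]\<^bsub>add_monoid K\<^esub> group.ord (add_monoid K) \<one> = \<zero>"
    using group.pow_ord_eq_1[OF add.is_group, of \<one>] by simp
  then show ?thesis
    using assms(2) by (simp add: characteristic_def numeral_2_eq_2 nat_pow_def)
qed

text \<open>In characteristic \<open>2\<close>, \<open>1 - g = 1 + g\<close> and \<open>(1 + g)\<^sup>2 = 1 + g\<^sup>2 = 0\<close>. The product of \<open>1 + x\<close> and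
\<open>1 + y\<close> is the sum of all group elements, hence nonzero.\<close>

lemma (in finite_group_algebra) klein_square_zero_algebra:
  assumes K: "field K" and two: "\<one>\<^bsub>K\<^esub> \<oplus>\<^bsub>K\<^esub> \<one>\<^bsub>K\<^esub> = \<zero>\<^bsub>K\<^esub>"
    and x: "x \<in> carrier G" and y: "y \<in> carrier G"
    and sq: "\<And>g. g \<in> carrier G \<Longrightarrow> g \<otimes>\<^bsub>G\<^esub> g = \<one>\<^bsub>G\<^esub>"
    and carr: "carrier G = {\<one>\<^bsub>G\<^esub>, x, y, x \<otimes>\<^bsub>G\<^esub> y}"
    and dist: "distinct [\<one>\<^bsub>G\<^esub>, x, y, x \<otimes>\<^bsub>G\<^esub> y]"
  shows "square_zero_algebra KG K scalar augmentation
    (\<one>\<^bsub>KG\<^esub> \<ominus>\<^bsub>KG\<^esub> g_elt x) (\<one>\<^bsub>KG\<^esub> \<ominus>\<^bsub>KG\<^esub> g_elt y)"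
proof -
  interpret A: cring KG by (rule cring_KG)
  interpret F: field K by (rule K)
  interpret s: ring_hom_cring K KG scalar by unfold_locales (rule scalar_hom)
  have double: "c \<oplus>\<^bsub>K\<^esub> c = \<zero>\<^bsub>K\<^esub>" if "c \<in> carrier K" for c
    using that two K.r_distr[of "\<one>\<^bsub>K\<^esub>" "\<one>\<^bsub>K\<^esub>" c] by (metis K.l_distr K.l_null K.l_one K.one_closed)
  have double': "c \<oplus>\<^bsub>K\<^esub> (c \<oplus>\<^bsub>K\<^esub> d) = d" if "c \<in> carrier K" "d \<in> carrier K" for c d
    using that by (simp add: double flip: K.a_assoc)
  have doubleA: "a \<oplus>\<^bsub>KG\<^esub> a = \<zero>\<^bsub>KG\<^esub>" if "a \<in> carrier KG" for a
    using that by (auto simp: KG_simps double)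
  have minus: "\<one>\<^bsub>KG\<^esub> \<ominus>\<^bsub>KG\<^esub> a = \<one>\<^bsub>KG\<^esub> \<oplus>\<^bsub>KG\<^esub> a" if "a \<in> carrier KG" for a
    using that doubleA[OF that] by (simp add: A.minus_eq A.minus_equality)
  define u where "u = g_elt x"
  define v where "v = g_elt y"
  have uv [simp]: "u \<in> carrier KG" "v \<in> carrier KG" by (simp_all add: u_def v_def g_elt_closed)
  have X: "\<one>\<^bsub>KG\<^esub> \<ominus>\<^bsub>KG\<^esub> g_elt x = \<one>\<^bsub>KG\<^esub> \<oplus>\<^bsub>KG\<^esub> u"
    and Y: "\<one>\<^bsub>KG\<^esub> \<ominus>\<^bsub>KG\<^esub> g_elt y = \<one>\<^bsub>KG\<^esub> \<oplus>\<^bsub>KG\<^esub> v"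
    using minus[OF uv(1)] minus[OF uv(2)] by (simp_all add: u_def v_def)
  have zero: "(\<one>\<^bsub>KG\<^esub> \<oplus>\<^bsub>KG\<^esub> g_elt z) \<otimes>\<^bsub>KG\<^esub> (\<one>\<^bsub>KG\<^esub> \<oplus>\<^bsub>KG\<^esub> g_elt z) = \<zero>\<^bsub>KG\<^esub>"
    if z: "z \<in> carrier G" for z
  proof -
    have "g_elt z \<otimes>\<^bsub>KG\<^esub> g_elt z = \<one>\<^bsub>KG\<^esub>"
      using z by (simp add: g_elt_mult sq KG_simps(3))
    moreover have "(\<one>\<^bsub>KG\<^esub> \<oplus>\<^bsub>KG\<^esub> w) \<otimes>\<^bsub>KG\<^esub> (\<one>\<^bsub>KG\<^esub> \<oplus>\<^bsub>KG\<^esub> w)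
        = (\<one>\<^bsub>KG\<^esub> \<oplus>\<^bsub>KG\<^esub> w \<otimes>\<^bsub>KG\<^esub> w) \<oplus>\<^bsub>KG\<^esub> (w \<oplus>\<^bsub>KG\<^esub> w)" if "w \<in> carrier KG" for w
      using that by algebra
    ultimately show ?thesis using g_elt_closed[of z] by (simp add: doubleA)
  qed
  have XY: "(\<one>\<^bsub>KG\<^esub> \<oplus>\<^bsub>KG\<^esub> u) \<otimes>\<^bsub>KG\<^esub> (\<one>\<^bsub>KG\<^esub> \<oplus>\<^bsub>KG\<^esub> v)
      = \<one>\<^bsub>KG\<^esub> \<oplus>\<^bsub>KG\<^esub> u \<oplus>\<^bsub>KG\<^esub> v \<oplus>\<^bsub>KG\<^esub> g_elt (x \<otimes>\<^bsub>G\<^esub> y)"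
  proof -
    have "(\<one>\<^bsub>KG\<^esub> \<oplus>\<^bsub>KG\<^esub> u) \<otimes>\<^bsub>KG\<^esub> (\<one>\<^bsub>KG\<^esub> \<oplus>\<^bsub>KG\<^esub> v) = \<one>\<^bsub>KG\<^esub> \<oplus>\<^bsub>KG\<^esub> u \<oplus>\<^bsub>KG\<^esub> v \<oplus>\<^bsub>KG\<^esub> u \<otimes>\<^bsub>KG\<^esub> v"
      using uv by algebra
    then show ?thesis using x y by (simp add: u_def v_def g_elt_mult)
  qed
  have vX: "(\<one>\<^bsub>KG\<^esub> \<oplus>\<^bsub>KG\<^esub> u) g = (if g = \<one>\<^bsub>G\<^esub> \<or> g = x then \<one>\<^bsub>K\<^esub> else \<zero>\<^bsub>K\<^esub>)"
    if "g \<in> carrier G" for g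
    using that dist by (auto simp: KG_simps(3,5) u_def group_element_def)
  have vY: "(\<one>\<^bsub>KG\<^esub> \<oplus>\<^bsub>KG\<^esub> v) g = (if g = \<one>\<^bsub>G\<^esub> \<or> g = y then \<one>\<^bsub>K\<^esub> else \<zero>\<^bsub>K\<^esub>)"
    if "g \<in> carrier G" for g
    using that dist by (auto simp: KG_simps(3,5) v_def group_element_def)
  have vXY: "((\<one>\<^bsub>KG\<^esub> \<oplus>\<^bsub>KG\<^esub> u) \<otimes>\<^bsub>KG\<^esub> (\<one>\<^bsub>KG\<^esub> \<oplus>\<^bsub>KG\<^esub> v)) g = \<one>\<^bsub>K\<^esub>" if "g \<in> carrier G" for g
  proof -
    have "g = \<one>\<^bsub>G\<^esub> \<or> g = x \<or> g = y \<or> g = x \<otimes>\<^bsub>G\<^esub> y" using that unfolding carr by blast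
    then show ?thesis
      unfolding XY using dist x y
      by (elim disjE) (auto simp: KG_simps(3,5) u_def v_def group_element_def)
  qed
  show ?thesis
    unfolding X Y
  proof unfold_locales
    show "scalar \<in> ring_hom K KG" by (rule scalar_hom)
    show "augmentation \<in> ring_hom KG K" by (rule augmentation_hom)
    show "augmentation (scalar c) = c" if "c \<in> carrier K" for c
      using that by (simp add: scalar_def KG_simps(3) augmentation_smult)
    show "(\<one>\<^bsub>KG\<^esub> \<oplus>\<^bsub>KG\<^esub> u) \<otimes>\<^bsub>KG\<^esub> (\<one>\<^bsub>KG\<^esub> \<oplus>\<^bsub>KG\<^esub> u) = \<zero>\<^bsub>KG\<^esub>"
      "(\<one>\<^bsub>KG\<^esub> \<oplus>\<^bsub>KG\<^esub> v) \<otimes>\<^bsub>KG\<^esub> (\<one>\<^bsub>KG\<^esub> \<oplus>\<^bsub>KG\<^esub> v) = \<zero>\<^bsub>KG\<^esub>"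
      unfolding u_def v_def by (intro zero x y)+
    show "(\<one>\<^bsub>KG\<^esub> \<oplus>\<^bsub>KG\<^esub> u) \<otimes>\<^bsub>KG\<^esub> (\<one>\<^bsub>KG\<^esub> \<oplus>\<^bsub>KG\<^esub> v) \<noteq> \<zero>\<^bsub>KG\<^esub>"
    proof
      assume eq: "(\<one>\<^bsub>KG\<^esub> \<oplus>\<^bsub>KG\<^esub> u) \<otimes>\<^bsub>KG\<^esub> (\<one>\<^bsub>KG\<^esub> \<oplus>\<^bsub>KG\<^esub> v) = \<zero>\<^bsub>KG\<^esub>"
      have "\<one>\<^bsub>K\<^esub> = \<zero>\<^bsub>K\<^esub>" using vXY[OF x] x unfolding eq by (simp add: KG_simps(4))
      then show False by simp
    qed
    fix a assume a: "a \<in> carrier KG"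
    let ?xy = "x \<otimes>\<^bsub>G\<^esub> y"
    \<comment> \<open>Substituting \<open>x = 1 + \<xi>\<close> and \<open>y = 1 + \<eta>\<close> into \<open>a(1) + a(x) x + a(y) y + a(x y) x y\<close> gives these coefficients.\<close>
    let ?\<alpha> = "a \<one>\<^bsub>G\<^esub> \<oplus>\<^bsub>K\<^esub> a x \<oplus>\<^bsub>K\<^esub> a y \<oplus>\<^bsub>K\<^esub> a ?xy"
    let ?\<beta> = "a x \<oplus>\<^bsub>K\<^esub> a ?xy" and ?\<gamma> = "a y \<oplus>\<^bsub>K\<^esub> a ?xy" and ?\<delta> = "a ?xy"
    let ?X = "\<one>\<^bsub>KG\<^esub> \<oplus>\<^bsub>KG\<^esub> u" and ?Y = "\<one>\<^bsub>KG\<^esub> \<oplus>\<^bsub>KG\<^esub> v"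
    have ac: "a \<one>\<^bsub>G\<^esub> \<in> carrier K" "a x \<in> carrier K" "a y \<in> carrier K" "a ?xy \<in> carrier K"
      using a x y by auto
    have eq: "a = scalar ?\<alpha> \<oplus>\<^bsub>KG\<^esub> scalar ?\<beta> \<otimes>\<^bsub>KG\<^esub> ?X \<oplus>\<^bsub>KG\<^esub> scalar ?\<gamma> \<otimes>\<^bsub>KG\<^esub> ?Y
        \<oplus>\<^bsub>KG\<^esub> scalar ?\<delta> \<otimes>\<^bsub>KG\<^esub> (?X \<otimes>\<^bsub>KG\<^esub> ?Y)"
    proof (rule KG_eqI[OF a])
      fix g assume g: "g \<in> carrier G"
      have "(scalar ?\<alpha> \<oplus>\<^bsub>KG\<^esub> scalar ?\<beta> \<otimes>\<^bsub>KG\<^esub> ?X \<oplus>\<^bsub>KG\<^esub> scalar ?\<gamma> \<otimes>\<^bsub>KG\<^esub> ?Y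
          \<oplus>\<^bsub>KG\<^esub> scalar ?\<delta> \<otimes>\<^bsub>KG\<^esub> (?X \<otimes>\<^bsub>KG\<^esub> ?Y)) g
        = (if g = \<one>\<^bsub>G\<^esub> then ?\<alpha> else \<zero>\<^bsub>K\<^esub>) \<oplus>\<^bsub>K\<^esub> ?\<beta> \<otimes>\<^bsub>K\<^esub> ?X g \<oplus>\<^bsub>K\<^esub> ?\<gamma> \<otimes>\<^bsub>K\<^esub> ?Y g
          \<oplus>\<^bsub>K\<^esub> ?\<delta> \<otimes>\<^bsub>K\<^esub> (?X \<otimes>\<^bsub>KG\<^esub> ?Y) g"
      proof -
        have add: "(b \<oplus>\<^bsub>KG\<^esub> c) g = b g \<oplus>\<^bsub>K\<^esub> c g" for b c
          using g by (simp add: KG_simps(5))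
        have mult: "(scalar c \<otimes>\<^bsub>KG\<^esub> w) g = c \<otimes>\<^bsub>K\<^esub> w g" if "c \<in> carrier K" "w \<in> carrier KG" for c w
          using g by (simp add: scalar_mult[OF that] KG_simps(6))
        have const: "scalar c g = (if g = \<one>\<^bsub>G\<^esub> then c else \<zero>\<^bsub>K\<^esub>)" if "c \<in> carrier K" for c
          using g that by (simp add: scalar_def KG_simps(3,6) group_element_def)
        have closed: "?\<alpha> \<in> carrier K" "?\<beta> \<in> carrier K" "?\<gamma> \<in> carrier K" "?\<delta> \<in> carrier K"
          "?X \<in> carrier KG" "?Y \<in> carrier KG" "?X \<otimes>\<^bsub>KG\<^esub> ?Y \<in> carrier KG"
          using ac by simp_all
        show ?thesis
          unfolding add[of "scalar ?\<alpha> \<oplus>\<^bsub>KG\<^esub> scalar ?\<beta> \<otimes>\<^bsub>KG\<^esub> ?X \<oplus>\<^bsub>KG\<^esub> scalar ?\<gamma> \<otimes>\<^bsub>KG\<^esub> ?Y"]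
            add[of "scalar ?\<alpha> \<oplus>\<^bsub>KG\<^esub> scalar ?\<beta> \<otimes>\<^bsub>KG\<^esub> ?X"] add[of "scalar ?\<alpha>"]
            mult[OF closed(2,5)] mult[OF closed(3,6)] mult[OF closed(4,7)] const[OF closed(1)] ..
      qed
      also have "\<dots> = a g"
      proof -
        have "g = \<one>\<^bsub>G\<^esub> \<or> g = x \<or> g = y \<or> g = x \<otimes>\<^bsub>G\<^esub> y" using g unfolding carr by blast
        then show ?thesis
          unfolding vX[OF g] vY[OF g] vXY[OF g] using dist ac
          by (elim disjE) (auto simp: K.a_ac double double')
      qed
      finally show "a g = (scalar ?\<alpha> \<oplus>\<^bsub>KG\<^esub> scalar ?\<beta> \<otimes>\<^bsub>KG\<^esub> ?X \<oplus>\<^bsub>KG\<^esub> scalar ?\<gamma> \<otimes>\<^bsub>KG\<^esub> ?Y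
          \<oplus>\<^bsub>KG\<^esub> scalar ?\<delta> \<otimes>\<^bsub>KG\<^esub> (?X \<otimes>\<^bsub>KG\<^esub> ?Y)) g" ..
    qed (use ac in simp)
    show "\<exists>\<alpha>\<in>carrier K. \<exists>\<beta>\<in>carrier K. \<exists>\<gamma>\<in>carrier K. \<exists>\<delta>\<in>carrier K.
        a = scalar \<alpha> \<oplus>\<^bsub>KG\<^esub> scalar \<beta> \<otimes>\<^bsub>KG\<^esub> ?X \<oplus>\<^bsub>KG\<^esub> scalar \<gamma> \<otimes>\<^bsub>KG\<^esub> ?Y
          \<oplus>\<^bsub>KG\<^esub> scalar \<delta> \<otimes>\<^bsub>KG\<^esub> (?X \<otimes>\<^bsub>KG\<^esub> ?Y)"
      by (rule bexI[of _ ?\<alpha>], rule bexI[of _ ?\<beta>], rule bexI[of _ ?\<gamma>], rule bexI[of _ ?\<delta>], rule eq)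
        (use ac in simp_all)
  qed simp_all
qed

theorem mainTheorem1:
  fixes K :: "('k, 'c) ring_scheme" and G :: "('g, 'd) monoid_scheme" and x y :: 'g
  assumes "algebraically_closed K" and "characteristic K = 2"
    and "group G" and "G \<cong> integer_mod_group 2 \<times>\<times> integer_mod_group 2"
    and "x \<in> carrier G" and "y \<in> carrier G" and "generate G {x, y} = carrier G"
  defines "A \<equiv> group_algebra K G"
    and "kG \<equiv> regular_module (group_algebra K G)"
    and "k \<equiv> trivial_module K G"
    and "I \<equiv> ideal_X2_Y2 K"
  shows "projective_indecomposable TYPE('m) TYPE('n) A kG
    \<and> (\<exists>\<pi>. projective_cover TYPE('m) TYPE('n) A kG \<pi> k)
    \<and> (\<forall>n U. pim_decomposition TYPE('m) TYPE('n) A kG n U \<longleftrightarrow> n = 1 \<and> U 0 = carrier kG)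
    \<and> (\<exists>\<phi> \<in> ring_iso A (poly2 K Quot I).
         (\<forall>c \<in> carrier K. \<forall>a \<in> carrier A.
            \<phi> (c \<odot>\<^bsub>A\<^esub> a) = (I +>\<^bsub>poly2 K\<^esub> poly2_const K c) \<otimes>\<^bsub>poly2 K Quot I\<^esub> \<phi> a)
         \<and> \<phi> (\<one>\<^bsub>A\<^esub> \<ominus>\<^bsub>A\<^esub> group_element K G x) = I +>\<^bsub>poly2 K\<^esub> poly2_X K
         \<and> \<phi> (\<one>\<^bsub>A\<^esub> \<ominus>\<^bsub>A\<^esub> group_element K G y) = I +>\<^bsub>poly2 K\<^esub> poly2_Y K)
    \<and> modules_isomorphic A (radical_layer A kG 1) k
    \<and> modules_isomorphic A (radical_layer A kG 2) (direct_sum_module k k)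
    \<and> modules_isomorphic A (radical_layer A kG 3) k
    \<and> rad_pow A kG 3 = {\<zero>\<^bsub>kG\<^esub>}"
proof -
  interpret K: field K using assms(1) by (rule algebraically_closed.axioms(1))
  note klein = klein_four_group[OF assms(3-7)]
  interpret G: comm_group G by (rule klein(1))
  interpret finite_group_algebra K G
    by unfold_locales (simp add: klein(3))
  have "square_zero_algebra A K scalar augmentation
      (\<one>\<^bsub>A\<^esub> \<ominus>\<^bsub>A\<^esub> group_element K G x) (\<one>\<^bsub>A\<^esub> \<ominus>\<^bsub>A\<^esub> group_element K G y)"
    unfolding A_def
    using klein_square_zero_algebra[OF K.field_axioms characteristic_2[OF K.ring_axioms assms(2)]
        assms(5,6) klein(2-4)] .
  then interpret S: square_zero_algebra A K scalar augmentation
    "\<one>\<^bsub>A\<^esub> \<ominus>\<^bsub>A\<^esub> group_element K G x" "\<one>\<^bsub>A\<^esub> \<ominus>\<^bsub>A\<^esub> group_element K G y" .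
  have kG: "kG = regular_module A" by (simp add: kG_def A_def)
  have k: "k = scalar_restriction K augmentation"
    unfolding k_def trivial_module_def scalar_restriction_def augmentation_def ..
  obtain \<phi> where \<phi>: "\<phi> \<in> ring_iso A (poly2 K Quot I)"
    and const: "\<And>c. c \<in> carrier K \<Longrightarrow> \<phi> (scalar c) = I +>\<^bsub>poly2 K\<^esub> poly2_const K c"
    and XY: "\<phi> (\<one>\<^bsub>A\<^esub> \<ominus>\<^bsub>A\<^esub> group_element K G x) = I +>\<^bsub>poly2 K\<^esub> poly2_X K"
      "\<phi> (\<one>\<^bsub>A\<^esub> \<ominus>\<^bsub>A\<^esub> group_element K G y) = I +>\<^bsub>poly2 K\<^esub> poly2_Y K"
    using S.quotient_presentation unfolding I_def by blast
  have "\<phi> (c \<odot>\<^bsub>A\<^esub> a) = (I +>\<^bsub>poly2 K\<^esub> poly2_const K c) \<otimes>\<^bsub>poly2 K Quot I\<^esub> \<phi> a"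
    if c: "c \<in> carrier K" and a: "a \<in> carrier A" for c a
  proof -
    have "c \<odot>\<^bsub>A\<^esub> a = scalar c \<otimes>\<^bsub>A\<^esub> a" using scalar_mult[OF c] a by (simp add: A_def)
    then show ?thesis
      using ring_iso_memE(2)[OF \<phi> S.iota.hom_closed[OF c] a] by (simp only: const[OF c])
  qed
  then have "\<exists>\<phi> \<in> ring_iso A (poly2 K Quot I).
         (\<forall>c \<in> carrier K. \<forall>a \<in> carrier A.
            \<phi> (c \<odot>\<^bsub>A\<^esub> a) = (I +>\<^bsub>poly2 K\<^esub> poly2_const K c) \<otimes>\<^bsub>poly2 K Quot I\<^esub> \<phi> a)
         \<and> \<phi> (\<one>\<^bsub>A\<^esub> \<ominus>\<^bsub>A\<^esub> group_element K G x) = I +>\<^bsub>poly2 K\<^esub> poly2_X K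
         \<and> \<phi> (\<one>\<^bsub>A\<^esub> \<ominus>\<^bsub>A\<^esub> group_element K G y) = I +>\<^bsub>poly2 K\<^esub> poly2_Y K"
    using \<phi> XY by blast
  then show ?thesis
    unfolding kG k regular_module_simps
    by (intro conjI allI S.projective_indecomposable_regular exI[of _ augmentation]
        S.projective_cover_regular S.pim_decomposition_regular_iff
        S.layer_top S.layer_middle S.layer_bottom S.rad_pow_regular)
qed

end
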